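(* In the discrete-speed model, for the Speeds&Scheduling problem on $m$ identical cores, the algorithm ILP-D-sched computes an optimal solution (in exponential time).
   Context: Problem setting: a directed acyclic graph $G=(V,E)$ of tasks with weights $w_i\ge 0$, $m$ identical cores, a deadline $D>0$, a constant $\alpha\ge 1$, and $k$ eligible speeds $v_1<\dots<v_k$. Each task $i$ runs non-preemptively on one core at a single speed $s_i\in\{v_1,\dots,v_k\}$, taking time $w_i/s_i$ and consuming energy $w_i s_i^{\alpha-1}$. An arc $(i,j)\in E$ means $j$ cannot start before $i$ completes. Speeds&Scheduling problem: choose speeds, a core for each task and start times so that tasks on the same core do not overlap, precedence constraints hold, all tasks complete by $D$, and total energy is minimized. Algorithm ILP-D-sched: solve the integer linear program with binary variables $y_{i,\ell}$ (task $i$ at speed $v_\ell$), $z_{i,c}$ (task $i$ on core $c$), $e_{i,j}$ (task $i$ scheduled before task $j$), and real variables $d_i$ (completion times): minimize $\sum_{i\in V} w_i\sum_{\ell\le k}v_\ell^{\alpha-1}y_{i,\ell}$ subject to $d_i\le D$ for all $i$; $\sum_{\ell\le k}\frac{w_i}{v_\ell}y_{i,\ell}\le d_i$ for all $i$; $d_i+\sum_{\ell\le k}\frac{w_j}{v_\ell}y_{j,\ell}\le d_j+D(1-e_{i,j})$ for all $i,j\in V$ with $i\ne j$; $\sum_{\ell\le k}y_{i,\ell}=1$ for all $i$; $\sum_{c\le m}z_{i,c}=1$ for all $i$; $y_{i,\ell},z_{i,c},e_{i,j}\in\{0,1\}$; $e_{i,j}=1$ for all $(i,j)\in E$; $z_{i,c}+z_{j,c}-e_{i,j}-e_{j,i}\le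 1$ for all $i,j\in V$ with $i\ne j$ and all $c\le m$. The output assigns each task the speed and core indicated by $y$ and $z$ and completion time $d_i$. *)

theory Defs
  imports Complex_Main "HOL-Computational_Algebra.Polynomial"
begin

section \<open>The scheduling problem\<close>

text \<open>Tasks, cores and speeds are numbered from 1.\<close>

record problem =
  ntasks :: nat
  arcs :: "(nat \<times> nat) set"
  weight :: "nat \<Rightarrow> real"
  ncores :: nat
  deadline :: real
  alpha :: real
  nspeeds :: nat
  speed :: "nat \<Rightarrow> real"

abbreviation tasks :: "problem \<Rightarrow> nat set" where
  "tasks P \<equiv> {1..ntasks P}"

definition well_formed :: "problem \<Rightarrow> bool" where
  "well_formed P \<longleftrightarrow>
     arcs P \<subseteq> tasks P \<times> tasks P \<and> acyclic (arcs P) \<and>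
     (\<forall>i\<in>tasks P. 0 \<le> weight P i) \<and>
     1 \<le> ncores P \<and> 0 < deadline P \<and> 1 \<le> alpha P \<and>
     1 \<le> nspeeds P \<and> 0 < speed P 1 \<and> strict_mono_on {1..nspeeds P} (speed P)"

record schedule =
  task_speed :: "nat \<Rightarrow> real"
  task_core :: "nat \<Rightarrow> nat"
  task_start :: "nat \<Rightarrow> real"

definition completion :: "problem \<Rightarrow> schedule \<Rightarrow> nat \<Rightarrow> real" where
  "completion P S i = task_start S i + weight P i / task_speed S i"

definition energy :: "problem \<Rightarrow> schedule \<Rightarrow> real" where
  "energy P S = (\<Sum>i\<in>tasks P. weight P i * task_speed S i powr (alpha P - 1))"

text \<open>A core processes its tasks one after the other. In particular a task of weight 0 may not be
  placed strictly inside the execution interval of another task on the same core.\<close>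

definition feasible_schedule :: "problem \<Rightarrow> schedule \<Rightarrow> bool" where
  "feasible_schedule P S \<longleftrightarrow>
     (\<forall>i\<in>tasks P. task_speed S i \<in> speed P ` {1..nspeeds P} \<and>
        task_core S i \<in> {1..ncores P} \<and>
        0 \<le> task_start S i \<and> completion P S i \<le> deadline P) \<and>
     (\<forall>i\<in>tasks P. \<forall>j\<in>tasks P. i \<noteq> j \<and> task_core S i = task_core S j \<longrightarrow>
        completion P S i \<le> task_start S j \<or> completion P S j \<le> task_start S i) \<and>
     (\<forall>(i, j)\<in>arcs P. completion P S i \<le> task_start S j)"

definition optimal_schedule :: "problem \<Rightarrow> schedule \<Rightarrow> bool" where
  "optimal_schedule P S \<longleftrightarrow> feasible_schedule P S \<and>
     (\<forall>S'. feasible_schedule P S' \<longrightarrow> energy P S \<le> energy P S')"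


section \<open>The integer linear program\<close>

record ilp_vars =
  ilp_y :: "nat \<Rightarrow> nat \<Rightarrow> real"
  ilp_z :: "nat \<Rightarrow> nat \<Rightarrow> real"
  ilp_e :: "nat \<Rightarrow> nat \<Rightarrow> real"
  ilp_d :: "nat \<Rightarrow> real"

definition ilp_objective :: "problem \<Rightarrow> ilp_vars \<Rightarrow> real" where
  "ilp_objective P x =
     (\<Sum>i\<in>tasks P. weight P i * (\<Sum>l=1..nspeeds P. speed P l powr (alpha P - 1) * ilp_y x i l))"

definition ilp_feasible :: "problem \<Rightarrow> ilp_vars \<Rightarrow> bool" where
  "ilp_feasible P x \<longleftrightarrow>
     (\<forall>i\<in>tasks P. ilp_d x i \<le> deadline P) \<and>
     (\<forall>i\<in>tasks P. (\<Sum>l=1..nspeeds P. weight P i / speed P l * ilp_y x i l) \<le> ilp_d x i) \<and>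
     (\<forall>i\<in>tasks P. \<forall>j\<in>tasks P. i \<noteq> j \<longrightarrow>
        ilp_d x i + (\<Sum>l=1..nspeeds P. weight P j / speed P l * ilp_y x j l)
          \<le> ilp_d x j + deadline P * (1 - ilp_e x i j)) \<and>
     (\<forall>i\<in>tasks P. (\<Sum>l=1..nspeeds P. ilp_y x i l) = 1) \<and>
     (\<forall>i\<in>tasks P. (\<Sum>c=1..ncores P. ilp_z x i c) = 1) \<and>
     (\<forall>i\<in>tasks P. \<forall>l\<in>{1..nspeeds P}. ilp_y x i l \<in> {0, 1}) \<and>
     (\<forall>i\<in>tasks P. \<forall>c\<in>{1..ncores P}. ilp_z x i c \<in> {0, 1}) \<and>
     (\<forall>i\<in>tasks P. \<forall>j\<in>tasks P. ilp_e x i j \<in> {0, 1}) \<and>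
     (\<forall>(i, j)\<in>arcs P. ilp_e x i j = 1) \<and>
     (\<forall>i\<in>tasks P. \<forall>j\<in>tasks P. \<forall>c\<in>{1..ncores P}. i \<noteq> j \<longrightarrow>
        ilp_z x i c + ilp_z x j c - ilp_e x i j - ilp_e x j i \<le> 1)"

definition ilp_optimal :: "problem \<Rightarrow> ilp_vars \<Rightarrow> bool" where
  "ilp_optimal P x \<longleftrightarrow> ilp_feasible P x \<and>
     (\<forall>x'. ilp_feasible P x' \<longrightarrow> ilp_objective P x \<le> ilp_objective P x')"

definition indicated_schedule :: "problem \<Rightarrow> ilp_vars \<Rightarrow> schedule \<Rightarrow> bool" where
  "indicated_schedule P x S \<longleftrightarrow> (\<forall>i\<in>tasks P.
     (\<exists>l\<in>{1..nspeeds P}. ilp_y x i l = 1 \<and> task_speed S i = speed P l) \<and>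
     (\<exists>c\<in>{1..ncores P}. ilp_z x i c = 1 \<and> task_core S i = c) \<and>
     completion P S i = ilp_d x i)"

text \<open>The input/output relation of the algorithm: it is nondeterministic, because any optimal
  solution of the integer program may be used.\<close>

definition ILP_D_sched :: "problem \<Rightarrow> schedule \<Rightarrow> bool" where
  "ILP_D_sched P S \<longleftrightarrow> (\<exists>x. ilp_optimal P x \<and> indicated_schedule P x S)"


section \<open>Running time\<close>

text \<open>The data are real numbers, so running time is measured on a real random access machine,
  presented as a while language. Its memory consists of named two-dimensional arrays of natural
  numbers and of real numbers. Natural numbers serve as addresses and counters and only support
  addition and (truncated) subtraction. Real powers are a basic operation since the energies
  cannot be obtained from the input by field operations alone; there is no rounding of reals.

  Every assignment and every evaluation of a guard costs one unit. A program is fixed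
  independently of the input, so counting the individual operations within expressions would only
  change running times by a constant factor.\<close>

datatype nexp =
    NConst nat
  | NRead string nexp nexp
  | NAdd nexp nexp
  | NSub nexp nexp

datatype rexp =
    ROfNat nexp
  | RRead string nexp nexp
  | RAdd rexp rexp
  | RSub rexp rexp
  | RMul rexp rexp
  | RDiv rexp rexp
  | RPowr rexp rexp

datatype bexp =
    NLess nexp nexp
  | RLess rexp rexp
  | BNot bexp
  | BAnd bexp bexp

datatype com =
    Skip
  | NAssign string nexp nexp nexp
  | RAssign string nexp nexp rexp
  | Seq com com
  | If bexp com com
  | While bexp com

record memory =
  nats :: "string \<Rightarrow> nat \<Rightarrow> nat \<Rightarrow> nat"
  reals :: "string \<Rightarrow> nat \<Rightarrow> nat \<Rightarrow> real"

definition update :: "(string \<Rightarrow> nat \<Rightarrow> nat \<Rightarrow> 'v) \<Rightarrow> string \<Rightarrow> nat \<Rightarrow> nat \<Rightarrow> 'v \<Rightarrow> string \<Rightarrow> nat \<Rightarrow> nat \<Rightarrow> 'v"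
  where "update f a i j r = f(a := (f a)(i := (f a i)(j := r)))"

primrec nval :: "nexp \<Rightarrow> memory \<Rightarrow> nat" where
  "nval (NConst n) s = n"
| "nval (NRead a p q) s = nats s a (nval p s) (nval q s)"
| "nval (NAdd p q) s = nval p s + nval q s"
| "nval (NSub p q) s = nval p s - nval q s"

primrec rval :: "rexp \<Rightarrow> memory \<Rightarrow> real" where
  "rval (ROfNat p) s = real (nval p s)"
| "rval (RRead a p q) s = reals s a (nval p s) (nval q s)"
| "rval (RAdd p q) s = rval p s + rval q s"
| "rval (RSub p q) s = rval p s - rval q s"
| "rval (RMul p q) s = rval p s * rval q s"
| "rval (RDiv p q) s = rval p s / rval q s"
| "rval (RPowr p q) s = rval p s powr rval q s"

primrec bval :: "bexp \<Rightarrow> memory \<Rightarrow> bool" where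
  "bval (NLess p q) s \<longleftrightarrow> nval p s < nval q s"
| "bval (RLess p q) s \<longleftrightarrow> rval p s < rval q s"
| "bval (BNot b) s \<longleftrightarrow> \<not> bval b s"
| "bval (BAnd b c) s \<longleftrightarrow> bval b s \<and> bval c s"

text \<open>\<open>exec c s t s'\<close>: started in memory \<open>s\<close>, the program \<open>c\<close> halts after exactly \<open>t\<close> steps in
  memory \<open>s'\<close>. Execution is deterministic.\<close>

inductive exec :: "com \<Rightarrow> memory \<Rightarrow> nat \<Rightarrow> memory \<Rightarrow> bool" where
  Skip: "exec Skip s 0 s"
| NAssign: "exec (NAssign a p q u) s 1
    (s\<lparr>nats := update (nats s) a (nval p s) (nval q s) (nval u s)\<rparr>)"
| RAssign: "exec (RAssign a p q u) s 1
    (s\<lparr>reals := update (reals s) a (nval p s) (nval q s) (rval u s)\<rparr>)"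
| Seq: "exec c1 s t1 s1 \<Longrightarrow> exec c2 s1 t2 s2 \<Longrightarrow> exec (Seq c1 c2) s (t1 + t2) s2"
| IfTrue: "bval b s \<Longrightarrow> exec c1 s t s1 \<Longrightarrow> exec (If b c1 c2) s (1 + t) s1"
| IfFalse: "\<not> bval b s \<Longrightarrow> exec c2 s t s1 \<Longrightarrow> exec (If b c1 c2) s (1 + t) s1"
| WhileFalse: "\<not> bval b s \<Longrightarrow> exec (While b c) s 1 s"
| WhileTrue: "bval b s \<Longrightarrow> exec c s t1 s1 \<Longrightarrow> exec (While b c) s1 t2 s2 \<Longrightarrow>
    exec (While b c) s (1 + t1 + t2) s2"

text \<open>Scalars are stored at index \<open>(0, 0)\<close> and vectors in column \<open>0\<close>; all other cells are 0, so
  that the memory holds no information beyond the problem data.\<close>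

definition input_memory :: "problem \<Rightarrow> memory" where
  "input_memory P = \<lparr>
     nats = (\<lambda>a i j.
       if a = ''n'' \<and> i = 0 \<and> j = 0 then ntasks P
       else if a = ''m'' \<and> i = 0 \<and> j = 0 then ncores P
       else if a = ''k'' \<and> i = 0 \<and> j = 0 then nspeeds P
       else if a = ''E'' \<and> (i, j) \<in> arcs P then 1
       else 0),
     reals = (\<lambda>a i j.
       if a = ''D'' \<and> i = 0 \<and> j = 0 then deadline P
       else if a = ''alpha'' \<and> i = 0 \<and> j = 0 then alpha P
       else if a = ''w'' \<and> i \<in> tasks P \<and> j = 0 then weight P i
       else if a = ''v'' \<and> i \<in> {1..nspeeds P} \<and> j = 0 then speed P i
       else 0)\<rparr>"

definition output_found :: "memory \<Rightarrow> bool" where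
  "output_found s \<longleftrightarrow> nats s ''found'' 0 0 = 1"

definition output_schedule :: "memory \<Rightarrow> schedule" where
  "output_schedule s = \<lparr>
     task_speed = (\<lambda>i. reals s ''speed'' i 0),
     task_core = (\<lambda>i. nats s ''core'' i 0),
     task_start = (\<lambda>i. reals s ''start'' i 0)\<rparr>"

text \<open>The integer program has \<open>n * k + n * m + n\<^sup>2\<close> binary variables, so exponential time is
  measured in \<open>n + m + k\<close>, where \<open>n\<close>, \<open>m\<close> and \<open>k\<close> are the numbers of tasks, cores and speeds.\<close>

definition problem_size :: "problem \<Rightarrow> nat" where
  "problem_size P = ntasks P + ncores P + nspeeds P"

end

theory Submission
  imports Defs
begin

text \<open>Setting \<open>e\<^sub>i\<^sub>j = 1\<close> whenever \<open>i\<close> completes before \<open>j\<close> starts turns a feasible schedule into a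
  feasible point of the integer program with the same energy, and every feasible point indicates a
  feasible schedule; hence the outputs of the algorithm are exactly the optimal schedules.

  A program that finds one need only try finitely many candidates. Shifting all tasks of a feasible
  schedule to the left makes each start time the length of a longest path, hence a sum of durations
  of distinct tasks. So a candidate is given by a \<open>0\<close>-\<open>1\<close> matrix with \<open>n\<close> rows and \<open>n + m + k\<close>
  columns, and all these matrices are the binary expansions of the numbers below
  \<open>2 ^ (n * (n + m + k))\<close>. The program decodes each number, tests the resulting schedule for
  feasibility, and remembers the number of the cheapest one.\<close>

section \<open>Feasible points of the integer program and feasible schedules\<close>

text \<open>Tasks of weight 0 are the obstacle to shifting schedules to the left. The relation
  \<open>completion P S i \<le> task_start S j\<close> has cycles among such tasks when they start
  together, and longest paths make no sense there; breaking ties by task number could contradict an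
  arc. The relation is therefore refined to a strict order that still contains every arc and still
  compares any two tasks sharing a core.

  The shift also settles that an optimum exists: speeds and cores are kept, so energies are kept,
  while real start times give way to finitely many families of subsets of tasks.

  The machine cannot multiply or divide natural numbers, so halving a candidate number takes time
  linear in that number, which may itself be exponential. This is affordable because bounds of the
  form \<open>2 ^ poly p z\<close> are closed under products. The program never builds the integer
  program: since every optimal schedule is an output of the algorithm, it may search among schedules
  directly.\<close>

lemma sum_01_eq_1:
  fixes f :: "'a \<Rightarrow> real"
  assumes "finite A" "\<forall>a\<in>A. f a \<in> {0, 1}" "sum f A = 1"
  obtains a where "a \<in> A" "f a = 1" "\<And>g :: 'a \<Rightarrow> real. (\<Sum>b\<in>A. g b * f b) = g a"
proof -
  have f: "f b = (if b \<in> {b \<in> A. f b = 1} then 1 else 0)" if "b \<in> A" for b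
    using assms(2) that by auto
  have "sum f A = (\<Sum>b\<in>A. if b \<in> {b \<in> A. f b = 1} then 1 else 0)"
    using f by (rule sum.cong[OF refl])
  also have "\<dots> = real (card {b \<in> A. f b = 1})"
    using assms(1) by (simp add: sum.If_cases Int_def)
  finally have "card {b \<in> A. f b = 1} = 1"
    using assms(3) by simp
  then obtain a where a: "{b \<in> A. f b = 1} = {a}"
    by (rule card_1_singletonE)
  have "(\<Sum>b\<in>A. g b * f b) = g a" for g :: "'a \<Rightarrow> real"
  proof -
    have "(\<Sum>b\<in>A. g b * f b) = (\<Sum>b\<in>A. if b = a then g b else 0)"
      by (rule sum.cong[OF refl], subst f, assumption, unfold a) simp
    also have "\<dots> = g a"
      using a assms(1) by (subst sum.delta) auto
    finally show ?thesis .
  qed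
  with a show thesis by (intro that[of a]) auto
qed

lemma sum_one_hot:
  fixes g :: "nat \<Rightarrow> real"
  assumes "a \<in> {1..n}"
  shows "(\<Sum>b=1..n. g b * (if b = a then 1 else 0)) = g a"
proof -
  have "(\<Sum>b=1..n. g b * (if b = a then 1 else 0)) = (\<Sum>b=1..n. if b = a then g b else 0)"
    by (rule sum.cong) simp_all
  with assms show ?thesis by simp
qed

lemma speed_pos:
  assumes "well_formed P" "l \<in> {1..nspeeds P}"
  shows "0 < speed P l"
proof -
  have "speed P 1 \<le> speed P l"
  proof (cases "l = 1")
    case False
    with assms show ?thesis
      by (intro less_imp_le strict_mono_onD[of "{1..nspeeds P}" "speed P"]) (simp_all add: well_formed_def)
  qed simp
  with assms(1) show ?thesis by (simp add: well_formed_def)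
qed

lemma ilp_feasibleD:
  assumes "ilp_feasible P x" "i \<in> tasks P"
  shows "ilp_d x i \<le> deadline P"
    "(\<Sum>l=1..nspeeds P. weight P i / speed P l * ilp_y x i l) \<le> ilp_d x i"
    "(\<Sum>l=1..nspeeds P. ilp_y x i l) = 1" "(\<Sum>c=1..ncores P. ilp_z x i c) = 1"
    "\<forall>l\<in>{1..nspeeds P}. ilp_y x i l \<in> {0, 1}" "\<forall>c\<in>{1..ncores P}. ilp_z x i c \<in> {0, 1}"
  using assms by (simp_all add: ilp_feasible_def)

lemma indicated_scheduleE:
  assumes "ilp_feasible P x" "indicated_schedule P x S" "i \<in> tasks P"
  obtains l c where "l \<in> {1..nspeeds P}" "task_speed S i = speed P l"
    "\<And>g. (\<Sum>l=1..nspeeds P. g l * ilp_y x i l) = g l"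
    "c \<in> {1..ncores P}" "ilp_z x i c = 1" "task_core S i = c"
    "completion P S i = ilp_d x i"
proof -
  obtain l where l: "l \<in> {1..nspeeds P}" "ilp_y x i l = 1" "task_speed S i = speed P l"
    using assms(2,3) unfolding indicated_schedule_def by blast
  obtain l' where l': "l' \<in> {1..nspeeds P}"
    "\<And>g :: nat \<Rightarrow> real. (\<Sum>l=1..nspeeds P. g l * ilp_y x i l) = g l'"
    using sum_01_eq_1[OF _ ilp_feasibleD(5,3)[OF assms(1,3)]] by blast
  \<comment> \<open>The index \<open>l\<close> comes from the schedule, \<open>l'\<close> from the
    row of \<open>ilp_y\<close> summing to 1. Testing the weighted sum with the indicator of
    \<open>l\<close> identifies the two.\<close>
  have "l' = l"
  proof (rule ccontr)
    assume "l' \<noteq> l"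
    have "(\<Sum>j=1..nspeeds P. (if j = l then 1 else 0) * ilp_y x i j)
        = (\<Sum>j=1..nspeeds P. ilp_y x i j * (if j = l then 1 else 0))"
      by (simp add: mult.commute)
    also have "\<dots> = 1"
      using sum_one_hot[OF l(1)] l(2) by simp
    finally show False
      using l'(2)[of "\<lambda>j. if j = l then 1 else 0"] \<open>l' \<noteq> l\<close> by simp
  qed
  moreover obtain c where "c \<in> {1..ncores P}" "ilp_z x i c = 1" "task_core S i = c"
    "completion P S i = ilp_d x i"
    using assms(2,3) unfolding indicated_schedule_def by blast
  ultimately show thesis
    using l l' by (intro that) simp_all
qed

lemma indicated_schedule_energy:
  assumes "ilp_feasible P x" "indicated_schedule P x S"
  shows "energy P S = ilp_objective P x"
  unfolding energy_def ilp_objective_def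
proof (rule sum.cong[OF refl])
  fix i assume "i \<in> tasks P"
  then obtain l where "task_speed S i = speed P l"
    "\<And>g. (\<Sum>l=1..nspeeds P. g l * ilp_y x i l) = g l"
    by (rule indicated_scheduleE[OF assms]) blast
  then show "weight P i * task_speed S i powr (alpha P - 1)
      = weight P i * (\<Sum>l=1..nspeeds P. speed P l powr (alpha P - 1) * ilp_y x i l)"
    by (simp only:)
qed

lemma indicated_schedule_duration:
  assumes "ilp_feasible P x" "indicated_schedule P x S" "i \<in> tasks P"
  shows "(\<Sum>l=1..nspeeds P. weight P i / speed P l * ilp_y x i l) = weight P i / task_speed S i"
proof -
  from assms obtain l where "task_speed S i = speed P l"
    "\<And>g. (\<Sum>l=1..nspeeds P. g l * ilp_y x i l) = g l"
    by (rule indicated_scheduleE) blast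
  then show ?thesis by (simp only:)
qed

lemma indicated_schedule_feasible:
  assumes wf: "well_formed P" and feas: "ilp_feasible P x" and ind: "indicated_schedule P x S"
  shows "feasible_schedule P S"
proof -
  note dur = indicated_schedule_duration[OF feas ind]
  have d: "completion P S i = ilp_d x i" if "i \<in> tasks P" for i
    using ind that by (simp add: indicated_schedule_def)
  have order: "completion P S i \<le> task_start S j"
    if "i \<in> tasks P" "j \<in> tasks P" "i \<noteq> j" "ilp_e x i j = 1" for i j
  proof -
    have "ilp_d x i + (\<Sum>l=1..nspeeds P. weight P j / speed P l * ilp_y x j l)
        \<le> ilp_d x j + deadline P * (1 - ilp_e x i j)"
      using feas that(1-3) unfolding ilp_feasible_def by blast
    \<comment> \<open>As \<open>ilp_e x i j = 1\<close>, the slack term vanishes; moving the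
      duration of \<open>j\<close> to the right-hand side turns its completion into its
      start.\<close>
    with d[OF that(1)] d[OF that(2)] dur[OF that(2)] that(4) show ?thesis
      by (simp add: completion_def)
  qed
  have "task_speed S i \<in> speed P ` {1..nspeeds P} \<and> task_core S i \<in> {1..ncores P} \<and>
      0 \<le> task_start S i \<and> completion P S i \<le> deadline P" if i: "i \<in> tasks P" for i
  proof -
    have "weight P i / task_speed S i \<le> ilp_d x i" "ilp_d x i \<le> deadline P"
      using ilp_feasibleD(1,2)[OF feas i] dur[OF i] by simp_all
    moreover have "task_speed S i \<in> speed P ` {1..nspeeds P}" "task_core S i \<in> {1..ncores P}"
      using ind i unfolding indicated_schedule_def by blast+
    ultimately show ?thesis
      using d[OF i] by (simp add: completion_def)
  qed
  moreover have "completion P S i \<le> task_start S j \<or> completion P S j \<le> task_start S i"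
    if ij: "i \<in> tasks P" "j \<in> tasks P" "i \<noteq> j" "task_core S i = task_core S j" for i j
  proof -
    obtain c where c: "c \<in> {1..ncores P}" "ilp_z x i c = 1" "ilp_z x j c = 1"
      using ind ij(1,2,4) unfolding indicated_schedule_def by metis
    have "ilp_z x i c + ilp_z x j c - ilp_e x i j - ilp_e x j i \<le> 1"
      using feas ij(1-3) c(1) unfolding ilp_feasible_def by blast
    moreover have "ilp_e x i j \<in> {0, 1}" "ilp_e x j i \<in> {0, 1}"
      using feas ij(1,2) unfolding ilp_feasible_def by blast+
    ultimately have "ilp_e x i j = 1 \<or> ilp_e x j i = 1"
      using c by auto
    with order ij(1-3) show ?thesis by blast
  qed
  moreover have "completion P S i \<le> task_start S j" if "(i, j) \<in> arcs P" for i j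
  proof (rule order)
    show "i \<in> tasks P" "j \<in> tasks P"
      using wf that by (auto simp: well_formed_def)
    \<comment> \<open>The ordering constraints are stated for distinct tasks only; acyclicity
      excludes arcs from a task to itself.\<close>
    show "i \<noteq> j"
      using wf that by (auto simp: well_formed_def acyclic_def)
    show "ilp_e x i j = 1"
      using feas that unfolding ilp_feasible_def by blast
  qed
  ultimately show ?thesis
    unfolding feasible_schedule_def by blast
qed

text \<open>Lets an arbitrary feasible point compete with an optimal schedule when the latter is
  traced back to an optimal point.\<close>

lemma ex_indicated_schedule:
  assumes "ilp_feasible P x"
  shows "\<exists>S. indicated_schedule P x S"
proof -
  have "\<exists>l\<in>{1..nspeeds P}. ilp_y x i l = 1" if "i \<in> tasks P" for i
    using sum_01_eq_1[OF _ ilp_feasibleD(5,3)[OF assms that]] by blast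
  then obtain l where l: "\<And>i. i \<in> tasks P \<Longrightarrow> l i \<in> {1..nspeeds P} \<and> ilp_y x i (l i) = 1"
    by metis
  have "\<exists>c\<in>{1..ncores P}. ilp_z x i c = 1" if "i \<in> tasks P" for i
    using sum_01_eq_1[OF _ ilp_feasibleD(6,4)[OF assms that]] by blast
  then obtain c where c: "\<And>i. i \<in> tasks P \<Longrightarrow> c i \<in> {1..ncores P} \<and> ilp_z x i (c i) = 1"
    by metis
  have "indicated_schedule P x \<lparr>task_speed = \<lambda>i. speed P (l i), task_core = c,
      task_start = \<lambda>i. ilp_d x i - weight P i / speed P (l i)\<rparr>"
    unfolding indicated_schedule_def using l c by (fastforce simp: completion_def)
  then show ?thesis ..
qed

lemma feasible_schedule_indicated:
  assumes wf: "well_formed P" and feas: "feasible_schedule P S"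
  shows "\<exists>x. ilp_feasible P x \<and> indicated_schedule P x S"
proof -
  have "\<exists>l\<in>{1..nspeeds P}. task_speed S i = speed P l" if "i \<in> tasks P" for i
    using feas that by (auto simp: feasible_schedule_def)
  then obtain l where l: "\<And>i. i \<in> tasks P \<Longrightarrow> l i \<in> {1..nspeeds P} \<and> task_speed S i = speed P (l i)"
    by metis
  \<comment> \<open>For two tasks of weight 0 that start together, \<open>ilp_e\<close> becomes 1 in
    both directions; the constraints permit this.\<close>
  define x where "x = \<lparr>ilp_y = \<lambda>i j. if j = l i then 1 else 0,
    ilp_z = \<lambda>i c. if c = task_core S i then 1 else 0,
    ilp_e = \<lambda>i j. if completion P S i \<le> task_start S j then 1 else 0,
    ilp_d = completion P S\<rparr>"
  have task: "task_core S i \<in> {1..ncores P}" "0 \<le> task_start S i" "completion P S i \<le> deadline P"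
    if "i \<in> tasks P" for i
    using feas that by (auto simp: feasible_schedule_def)
  have sum_y: "(\<Sum>j=1..nspeeds P. g j * ilp_y x i j) = g (l i)" if "i \<in> tasks P" for i and g
    using sum_one_hot[of "l i"] l[OF that] by (simp add: x_def)
  have sum_z: "(\<Sum>j=1..ncores P. g j * ilp_z x i j) = g (task_core S i)" if "i \<in> tasks P" for i and g
    using sum_one_hot[of "task_core S i"] task(1)[OF that] by (simp add: x_def)
  have "indicated_schedule P x S"
    using l task(1) by (auto simp: indicated_schedule_def x_def)
  moreover have "ilp_feasible P x"
    unfolding ilp_feasible_def
  proof (intro conjI ballI impI; (unfold case_prod_beta)?)
    fix i j assume ij: "i \<in> tasks P" "j \<in> tasks P"
    \<comment> \<open>These two facts are what the case \<open>ilp_e x i j = 0\<close> needs: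
      \<open>deadline P\<close> covers the completion of \<open>i\<close>, and the rest of the
      inequality says that \<open>j\<close> starts no earlier than 0.\<close>
    have "completion P S i \<le> deadline P" "0 \<le> task_start S j"
      using task ij by auto
    with l[OF ij(2)] show "ilp_d x i + (\<Sum>l=1..nspeeds P. weight P j / speed P l * ilp_y x j l)
        \<le> ilp_d x j + deadline P * (1 - ilp_e x i j)"
      unfolding sum_y[OF ij(2)] by (auto simp: x_def completion_def)
  next
    fix i j c assume "i \<in> tasks P" "j \<in> tasks P" "c \<in> {1..ncores P}" "i \<noteq> j"
    moreover from this have "task_core S i = task_core S j \<Longrightarrow>
        completion P S i \<le> task_start S j \<or> completion P S j \<le> task_start S i"
      using feas unfolding feasible_schedule_def by blast
    ultimately show "ilp_z x i c + ilp_z x j c - ilp_e x i j - ilp_e x j i \<le> 1"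
      by (auto simp: x_def)
  next
    fix i assume i: "i \<in> tasks P"
    show "(\<Sum>l=1..nspeeds P. ilp_y x i l) = 1"
      using sum_y[OF i, of "\<lambda>_. 1"] by simp
    show "(\<Sum>c=1..ncores P. ilp_z x i c) = 1"
      using sum_z[OF i, of "\<lambda>_. 1"] by simp
    show "(\<Sum>l=1..nspeeds P. weight P i / speed P l * ilp_y x i l) \<le> ilp_d x i"
      using l[OF i] task(2)[OF i] unfolding sum_y[OF i] by (simp add: x_def completion_def)
    show "ilp_d x i \<le> deadline P"
      using task(3)[OF i] by (simp add: x_def)
  next
    fix a assume "a \<in> arcs P"
    with feas show "ilp_e x (fst a) (snd a) = 1"
      by (auto simp: feasible_schedule_def x_def)
  qed (simp_all add: x_def)
  ultimately show ?thesis by blast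
qed

text \<open>The translations in both directions preserve the objective, so the minima coincide. The
  direction from right to left is the one that allows a search among schedules to count as an
  execution of the algorithm.\<close>

lemma ILP_D_sched_iff_optimal:
  assumes wf: "well_formed P"
  shows "ILP_D_sched P S \<longleftrightarrow> optimal_schedule P S"
proof
  assume "ILP_D_sched P S"
  then obtain x where x: "ilp_optimal P x" "indicated_schedule P x S"
    by (auto simp: ILP_D_sched_def)
  then have feas: "ilp_feasible P x"
    by (simp add: ilp_optimal_def)
  have "energy P S \<le> energy P S'" if "feasible_schedule P S'" for S'
    using feasible_schedule_indicated[OF wf that] x feas
    by (auto simp: ilp_optimal_def indicated_schedule_energy)
  then show "optimal_schedule P S"
    using indicated_schedule_feasible[OF wf feas x(2)] by (simp add: optimal_schedule_def)
next
  assume S: "optimal_schedule P S"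
  then obtain x where x: "ilp_feasible P x" "indicated_schedule P x S"
    using feasible_schedule_indicated[OF wf] by (auto simp: optimal_schedule_def)
  have "ilp_objective P x \<le> ilp_objective P x'" if x': "ilp_feasible P x'" for x'
  proof -
    obtain S' where "indicated_schedule P x' S'"
      using ex_indicated_schedule[OF x'] ..
    with S x x' wf show ?thesis
      by (metis indicated_schedule_energy indicated_schedule_feasible optimal_schedule_def)
  qed
  with x show "ILP_D_sched P S"
    by (auto simp: ILP_D_sched_def ilp_optimal_def)
qed

section \<open>A finite set of candidate schedules\<close>

text \<open>The sets \<open>A j\<close> record a longest path ending in \<open>j\<close>.\<close>

lemma subset_sum_starts:
  fixes dur s :: "'a \<Rightarrow> real"
  assumes "finite T" "acyclic R" "R \<subseteq> T \<times> T"
    "\<And>i. i \<in> T \<Longrightarrow> 0 \<le> dur i" "\<And>i. i \<in> T \<Longrightarrow> 0 \<le> s i"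
    "\<And>i j. (i, j) \<in> R \<Longrightarrow> s i + dur i \<le> s j"
  shows "\<exists>A. (\<forall>i\<in>T. A i \<subseteq> {h. (h, i) \<in> R\<^sup>+} \<and> sum dur (A i) \<le> s i) \<and>
    (\<forall>(i, j)\<in>R. sum dur (A i) + dur i \<le> sum dur (A j))"
  using assms
proof (induction "card T" arbitrary: T R)
  case 0
  then show ?case by auto
next
  case (Suc n)
  have "finite R"
    using Suc.prems(1,3) by (meson finite_SigmaI finite_subset)
  then have "wf (R\<inverse>)"
    using Suc.prems(2) by (simp add: finite_acyclic_wf_converse)
  moreover have "T \<noteq> {}"
    using Suc.hyps(2) by auto
  \<comment> \<open>A sink: no path to another task passes through \<open>t\<close>, so the sets of
    the other tasks can be found without it.\<close>
  ultimately obtain t where t: "t \<in> T" "\<And>j. j \<in> T \<Longrightarrow> (t, j) \<notin> R"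
    by (metis converse_iff wfE_min')
  define R' where "R' = R \<inter> (T - {t}) \<times> (T - {t})"
  have R': "R' \<subseteq> R" by (auto simp: R'_def)
  have "\<exists>A. (\<forall>i\<in>T - {t}. A i \<subseteq> {h. (h, i) \<in> R'\<^sup>+} \<and> sum dur (A i) \<le> s i) \<and>
    (\<forall>(i, j)\<in>R'. sum dur (A i) + dur i \<le> sum dur (A j))"
  proof (rule Suc.hyps(1))
    show "n = card (T - {t})" using Suc.hyps(2) t(1) by simp
    show "acyclic R'" using Suc.prems(2) R' by (rule acyclic_subset)
  qed (use Suc.prems R' in \<open>auto simp: R'_def\<close>)
  then obtain A where A: "\<And>i. i \<in> T - {t} \<Longrightarrow> A i \<subseteq> {h. (h, i) \<in> R'\<^sup>+}"
    "\<And>i. i \<in> T - {t} \<Longrightarrow> sum dur (A i) \<le> s i"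
    "\<And>i j. (i, j) \<in> R' \<Longrightarrow> sum dur (A i) + dur i \<le> sum dur (A j)"
    by blast
  have A_R: "A i \<subseteq> {h. (h, i) \<in> R\<^sup>+}" if "i \<in> T - {t}" for i
    using A(1)[OF that] trancl_mono[OF _ R'] by blast
  have split: "(i, j) \<in> R' \<or> j = t \<and> i \<in> T - {t}" if "(i, j) \<in> R" for i j
    using that t(2) Suc.prems(3) by (auto simp: R'_def)
  \<comment> \<open>If \<open>t\<close> has predecessors, the new set is that of a predecessor
    \<open>i\<close> maximizing \<open>sum dur (A i) + dur i\<close>, extended by \<open>i\<close>
    itself; otherwise it is empty.\<close>
  have "\<exists>C. C \<subseteq> {h. (h, t) \<in> R\<^sup>+} \<and> sum dur C \<le> s t \<and>
      (\<forall>i. (i, t) \<in> R \<longrightarrow> sum dur (A i) + dur i \<le> sum dur C)"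
  proof (cases "{i. (i, t) \<in> R} = {}")
    case True
    with Suc.prems(5) t(1) show ?thesis
      by (intro exI[of _ "{}"]) auto
  next
    case False
    have "{i. (i, t) \<in> R} \<subseteq> T" using Suc.prems(3) by auto
    then have "finite {i. (i, t) \<in> R}"
      using Suc.prems(1) by (rule finite_subset)
    with False obtain i where i: "(i, t) \<in> R"
      and max: "\<And>i'. (i', t) \<in> R \<Longrightarrow> sum dur (A i') + dur i' \<le> sum dur (A i) + dur i"
      using obtains_MAX[of "{i. (i, t) \<in> R}" "\<lambda>i. sum dur (A i) + dur i"]
      by (metis (no_types, lifting) Max_ge finite_imageI image_eqI mem_Collect_eq)
    have iT: "i \<in> T - {t}" using split[OF i] by (auto simp: R'_def)
    have "A i \<subseteq> T"
      using A_R[OF iT] trancl_subset_Sigma[OF Suc.prems(3)] by blast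
    then have "finite (A i)" using Suc.prems(1) finite_subset by blast
    \<comment> \<open>This is the reason for carrying the inclusion of \<open>A i\<close> in the
      strict ancestors of \<open>i\<close>: the duration of \<open>i\<close> is really added, not
      absorbed.\<close>
    moreover have "i \<notin> A i"
      using A_R[OF iT] Suc.prems(2) by (auto simp: acyclic_def)
    ultimately have sum: "sum dur (insert i (A i)) = sum dur (A i) + dur i" by simp
    have "insert i (A i) \<subseteq> {h. (h, t) \<in> R\<^sup>+}"
      using A_R[OF iT] i by (auto intro: trancl_into_trancl)
    moreover have "sum dur (insert i (A i)) \<le> s t"
      using sum A(2)[OF iT] Suc.prems(6)[OF i] by simp
    ultimately show ?thesis using sum max by metis
  qed
  then obtain C where C: "C \<subseteq> {h. (h, t) \<in> R\<^sup>+}" "sum dur C \<le> s t"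
    "\<And>i. (i, t) \<in> R \<Longrightarrow> sum dur (A i) + dur i \<le> sum dur C" by blast
  show ?case
  proof (rule exI[of _ "A(t := C)"], intro conjI ballI)
    fix i assume "i \<in> T"
    then show "(A(t := C)) i \<subseteq> {h. (h, i) \<in> R\<^sup>+}" "sum dur ((A(t := C)) i) \<le> s i"
      using A_R[of i] A(2)[of i] C(1,2) by auto
  next
    fix a assume a: "a \<in> R"
    obtain i j where ij: "a = (i, j)" by (cases a)
    have "i \<noteq> t" using a ij t Suc.prems(3) by auto
    with split[of i j] a ij A(3)[of i j] C(3)[of i]
    show "case a of (i, j) \<Rightarrow> sum dur ((A(t := C)) i) + dur i \<le> sum dur ((A(t := C)) j)"
      by (auto simp: R'_def)
  qed
qed

text \<open>A two-digit number in base \<open>Suc n\<close>: the leading digit counts strict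
  ancestors, the last one is the task number and makes the rank injective. Along an arc the set of
  strict ancestors grows properly, since in an acyclic relation \<open>i\<close> is not its own
  ancestor.\<close>

lemma ex_injective_topological_rank:
  fixes E :: "(nat \<times> nat) set"
  assumes "acyclic E" "E \<subseteq> {1..n} \<times> {1..n}"
  shows "\<exists>r :: nat \<Rightarrow> nat. inj_on r {1..n} \<and> (\<forall>(i, j)\<in>E. r i < r j)"
proof -
  define p where "p j = card {i. (i, j) \<in> E\<^sup>+}" for j
  define r where "r i = p i * Suc n + i" for i
  have r: "r i div Suc n = p i" "r i mod Suc n = i" if "i \<in> {1..n}" for i
    using that by (simp_all add: r_def del: mult_Suc_right)
  have "inj_on r {1..n}"
    by (rule inj_on_inverseI[of _ "\<lambda>x. x mod Suc n"]) (simp add: r)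
  moreover have "r i < r j" if "(i, j) \<in> E" for i j
  proof -
    have "i \<in> {1..n}" using that assms(2) by auto
    have "{h. (h, j) \<in> E\<^sup>+} \<subseteq> {1..n}"
      using trancl_subset_Sigma[OF assms(2)] by blast
    then have "finite {h. (h, j) \<in> E\<^sup>+}" by (rule finite_subset) simp
    moreover have "{h. (h, i) \<in> E\<^sup>+} \<subset> {h. (h, j) \<in> E\<^sup>+}"
      using that assms(1) by (auto simp: acyclic_def intro: trancl_into_trancl)
    ultimately have "p i < p j" unfolding p_def by (rule psubset_card_mono)
    then have "Suc (p i) * Suc n \<le> p j * Suc n" by (intro mult_le_mono1) simp
    with \<open>i \<in> {1..n}\<close> show ?thesis by (simp add: r_def)
  qed
  ultimately show ?thesis by blast
qed

text \<open>Longest paths in a strict order \<open>R\<close> read off from \<open>S\<close> are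
  lower bounds on the starts in \<open>S\<close>, so no task moves to the right and the deadline
  survives. For the other conditions \<open>R\<close> must compare tasks on a common core and
  contain the arcs.\<close>

lemma left_shifted_schedule:
  assumes wf: "well_formed P" and feas: "feasible_schedule P S"
  obtains A where
    "\<And>i. i \<in> tasks P \<Longrightarrow> A i \<subseteq> tasks P"
    "feasible_schedule P (S\<lparr>task_start := \<lambda>i. \<Sum>j\<in>A i. weight P j / task_speed S j\<rparr>)"
proof -
  define dur where "dur i = weight P i / task_speed S i" for i
  \<comment> \<open>Twice the midpoint of the execution interval. Unlike the start it separates a
    task of weight 0 from a longer task starting at the same moment.\<close>
  define key where "key i = task_start S i + completion P S i" for i
  have compl: "completion P S i = task_start S i + dur i" for i
    by (simp add: completion_def dur_def)
  have task: "task_speed S i \<in> speed P ` {1..nspeeds P}" "task_core S i \<in> {1..ncores P}"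
    "0 \<le> task_start S i" "completion P S i \<le> deadline P" if "i \<in> tasks P" for i
    using feas that by (auto simp: feasible_schedule_def)
  have dur: "0 \<le> dur i" if i: "i \<in> tasks P" for i
  proof -
    obtain l where "l \<in> {1..nspeeds P}" "task_speed S i = speed P l"
      using task(1)[OF i] by blast
    with speed_pos[OF wf] have "0 < task_speed S i" by simp
    moreover have "0 \<le> weight P i"
      using wf i unfolding well_formed_def by blast
    ultimately show ?thesis by (simp add: dur_def)
  qed
  have arcs: "arcs P \<subseteq> tasks P \<times> tasks P" "acyclic (arcs P)"
    using wf by (auto simp: well_formed_def)
  obtain r :: "nat \<Rightarrow> nat" where r: "inj_on r (tasks P)" "\<And>i j. (i, j) \<in> arcs P \<Longrightarrow> r i < r j"
    using ex_injective_topological_rank[OF arcs(2,1)] by blast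
  \<comment> \<open>The key does not separate tasks of weight 0 that start at the same time; there the rank decides.\<close>
  define R where "R = {(i, j). i \<in> tasks P \<and> j \<in> tasks P \<and> completion P S i \<le> task_start S j \<and>
    (key i < key j \<or> key i = key j \<and> r i < r j)}"
  have "trans R"
  proof (rule transI)
    fix h i j assume hi: "(h, i) \<in> R" and ij: "(i, j) \<in> R"
    have "0 \<le> dur i" using hi dur by (auto simp: R_def)
    with hi ij show "(h, j) \<in> R"
      by (auto simp: R_def compl)
  qed
  moreover have "irrefl R" by (auto simp: irrefl_def R_def)
  ultimately have R: "R\<^sup>+ = R" "acyclic R"
    by (simp_all add: acyclic_irrefl)
  have key_le: "key i \<le> key j"
    if "i \<in> tasks P" "j \<in> tasks P" "completion P S i \<le> task_start S j" for i j
    using that dur[of i] dur[of j] by (auto simp: key_def compl)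
  obtain A where A: "\<And>i. i \<in> tasks P \<Longrightarrow> A i \<subseteq> {h. (h, i) \<in> R}"
    "\<And>i. i \<in> tasks P \<Longrightarrow> sum dur (A i) \<le> task_start S i"
    "\<And>i j. (i, j) \<in> R \<Longrightarrow> sum dur (A i) + dur i \<le> sum dur (A j)"
  proof -
    have "\<exists>A. (\<forall>i\<in>tasks P. A i \<subseteq> {h. (h, i) \<in> R} \<and> sum dur (A i) \<le> task_start S i) \<and>
        (\<forall>(i, j)\<in>R. sum dur (A i) + dur i \<le> sum dur (A j))"
      using dur task(3)
      by (intro subset_sum_starts[of "tasks P" R dur "task_start S", unfolded R(1)] R(2))
        (auto simp: R_def compl)
    then show thesis using that by blast
  qed
  have sub: "A i \<subseteq> tasks P" if "i \<in> tasks P" for i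
    using A(1)[OF that] by (auto simp: R_def)
  let ?S = "S\<lparr>task_start := \<lambda>i. sum dur (A i)\<rparr>"
  have compl': "completion P ?S i = sum dur (A i) + dur i" for i
    by (simp add: completion_def dur_def)
  have "0 \<le> sum dur (A i)" if "i \<in> tasks P" for i
    using sub[OF that] dur by (intro sum_nonneg) auto
  moreover have "completion P ?S i \<le> deadline P" if "i \<in> tasks P" for i
    using A(2)[OF that] task(4)[OF that] by (simp add: compl compl')
  moreover have "(i, j) \<in> R \<or> (j, i) \<in> R"
    if "i \<in> tasks P" "j \<in> tasks P" "i \<noteq> j" "completion P S i \<le> task_start S j" for i j
  proof (cases "key i < key j")
    case True
    with that show ?thesis by (simp add: R_def)
  next
    case False
    \<comment> \<open>Equality in \<open>key_le\<close> forces both durations to be 0 and the starts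
      to coincide. Each task then completes before the other starts, and the injective rank chooses
      one of the two orders.\<close>
    then have "key i = key j" using key_le that by force
    moreover from this have "completion P S j \<le> task_start S i"
      using that dur[of i] dur[of j] by (auto simp: key_def compl)
    moreover have "r i \<noteq> r j" using r(1) that by (auto dest: inj_onD)
    ultimately show ?thesis using that by (auto simp: R_def)
  qed
  then have "completion P ?S i \<le> task_start ?S j \<or> completion P ?S j \<le> task_start ?S i"
    if "i \<in> tasks P" "j \<in> tasks P" "i \<noteq> j" "task_core S i = task_core S j" for i j
    using A(3) feas that unfolding compl' feasible_schedule_def by (simp, metis)
  moreover have "completion P ?S i \<le> task_start ?S j" if "(i, j) \<in> arcs P" for i j
  proof -
    have ij: "i \<in> tasks P" "j \<in> tasks P" using arcs(1) that by auto
    moreover have "completion P S i \<le> task_start S j"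
      using feas that by (auto simp: feasible_schedule_def)
    \<comment> \<open>If the keys agree, the rank has to point along the arc; hence the choice of a
      topological rank.\<close>
    ultimately have "(i, j) \<in> R" using key_le[OF ij] r(2)[OF that] by (auto simp: R_def)
    then show ?thesis using A(3) by (simp add: compl')
  qed
  ultimately have "feasible_schedule P ?S"
    using task unfolding feasible_schedule_def by auto
  with sub show thesis
    by (intro that) (simp_all add: dur_def[abs_def])
qed

section \<open>Numbers as 0-1 matrices\<close>

lemma ex_bits:
  fixes f :: "nat \<Rightarrow> nat"
  assumes "\<And>p. f p < 2"
  shows "\<exists>X < 2 ^ N. \<forall>p<N. X div 2 ^ p mod 2 = f p"
proof (induction N)
  case (Suc N)
  then obtain X where X: "X < 2 ^ N" "\<And>p. p < N \<Longrightarrow> X div 2 ^ p mod 2 = f p" by blast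
  have "(X + f N * 2 ^ N) div 2 ^ p mod 2 = f p" if "p < Suc N" for p
  proof (cases "p = N")
    case True
    with X(1) assms[of N] show ?thesis by simp
  next
    case False
    with that have p: "p < N" by simp
    \<comment> \<open>For \<open>p < N\<close> the new summand is an even multiple of
      \<open>2 ^ p\<close>, so bit \<open>p\<close> is left alone.\<close>
    then obtain d where "N = Suc (p + d)"
      using less_iff_Suc_add by blast
    then have "f N * 2 ^ N = (f N * 2 ^ d * 2) * 2 ^ p"
      by (simp add: power_add)
    then have "(X + f N * 2 ^ N) div 2 ^ p = X div 2 ^ p + f N * 2 ^ d * 2"
      by (simp only: div_mult_self1[OF power_not_zero[OF numeral_neq_zero]] add.commute)
    with X(2)[OF p] show ?thesis by simp
  qed
  moreover have "X + f N * 2 ^ N < 2 ^ Suc N"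
  proof -
    have "f N * 2 ^ N \<le> 1 * 2 ^ N" using assms[of N] by (intro mult_le_mono1) simp
    with X(1) show ?thesis unfolding power_Suc by linarith
  qed
  ultimately show ?case by blast
qed simp

text \<open>Row-major order with rows and columns counted from 1, like tasks. Consecutive cells are
  consecutive bits, so the matrix can be read by repeated halving.\<close>

definition bits :: "nat \<Rightarrow> nat \<Rightarrow> nat \<Rightarrow> nat \<Rightarrow> nat" where
  "bits K X i j = X div 2 ^ ((i - 1) * K + (j - 1)) mod 2"

lemma bit_index_div_mod:
  fixes i j K :: nat
  assumes "j \<in> {1..K}"
  shows "((i - 1) * K + (j - 1)) div K = i - 1" "((i - 1) * K + (j - 1)) mod K = j - 1"
proof -
  from assms have j: "j - 1 < K" by auto
  then show "((i - 1) * K + (j - 1)) div K = i - 1" by (subst div_mult_self3) simp_all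
  from j show "((i - 1) * K + (j - 1)) mod K = j - 1" by (subst mod_mult_self3) simp
qed

lemma bit_index_inj:
  fixes i j i' j' :: nat
  assumes "i \<ge> 1" "i' \<ge> 1" "j \<in> {1..K}" "j' \<in> {1..K}"
    and eq: "(i - 1) * K + (j - 1) = (i' - 1) * K + (j' - 1)"
  shows "i = i' \<and> j = j'"
proof -
  have "i - 1 = i' - 1" "j - 1 = j' - 1"
    using bit_index_div_mod[OF assms(3), of i] bit_index_div_mod[OF assms(4), of i'] eq by metis+
  with assms(1-4) show ?thesis by auto
qed

lemma ex_bits_matrix:
  assumes "\<And>i j. f i j < (2::nat)"
  shows "\<exists>X < 2 ^ (n * K). \<forall>i\<in>{1..n}. \<forall>j\<in>{1..K}. bits K X i j = f i j"
proof -
  obtain X where X: "X < 2 ^ (n * K)"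
    "\<And>p. p < n * K \<Longrightarrow> X div 2 ^ p mod 2 = f (Suc (p div K)) (Suc (p mod K))"
    using ex_bits[of "\<lambda>p. f (Suc (p div K)) (Suc (p mod K))"] assms by blast
  have "bits K X i j = f i j" if "i \<in> {1..n}" "j \<in> {1..K}" for i j
  proof -
    define p where "p = (i - 1) * K + (j - 1)"
    have "j - 1 < K" using that by auto
    then have "p < (i - 1) * K + K" by (simp add: p_def)
    also have "\<dots> = i * K" using that by (cases i) auto
    also have "\<dots> \<le> n * K" using that by simp
    finally have "p < n * K" .
    moreover have "Suc (p div K) = i" "Suc (p mod K) = j"
      using that bit_index_div_mod[OF that(2), of i] unfolding p_def by auto
    ultimately show ?thesis using X(2)[of p] by (simp only: bits_def p_def)
  qed
  with X(1) show ?thesis by blast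
qed

lemma bits_le_1: "bits K X i j \<le> 1"
  by (simp add: bits_def less_Suc_eq_le[symmetric])

text \<open>Row \<open>i\<close> of \<open>b\<close> lists, in this order, the tasks whose durations add up to the start time of
  task \<open>i\<close>, its core number in unary, and its speed index in unary.\<close>

definition decode :: "problem \<Rightarrow> (nat \<Rightarrow> nat \<Rightarrow> nat) \<Rightarrow> schedule" where
  "decode P b =
     (let v = (\<lambda>i. speed P (1 + (\<Sum>l=1..nspeeds P - 1. b i (ntasks P + ncores P + l))))
      in \<lparr>task_speed = v,
          task_core = (\<lambda>i. 1 + (\<Sum>c=1..ncores P - 1. b i (ntasks P + c))),
          task_start = (\<lambda>i. \<Sum>j=1..ntasks P. real (b i j) * (weight P j / v j))\<rparr>)"

definition candidate :: "problem \<Rightarrow> nat \<Rightarrow> schedule" where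
  "candidate P X = decode P (bits (problem_size P) X)"

lemma feasible_schedule_cong:
  assumes "arcs P \<subseteq> tasks P \<times> tasks P"
    "\<And>i. i \<in> tasks P \<Longrightarrow> task_speed S i = task_speed S' i"
    "\<And>i. i \<in> tasks P \<Longrightarrow> task_core S i = task_core S' i"
    "\<And>i. i \<in> tasks P \<Longrightarrow> task_start S i = task_start S' i"
  shows "feasible_schedule P S \<longleftrightarrow> feasible_schedule P S'"
proof -
  have "completion P S i = completion P S' i" if "i \<in> tasks P" for i
    using assms(2,4) that by (simp add: completion_def)
  moreover have arcs: "(\<forall>(i, j)\<in>arcs P. completion P S i \<le> task_start S j) \<longleftrightarrow>
      (\<forall>(i, j)\<in>arcs P. completion P S' i \<le> task_start S' j)"
    by (rule ball_cong[OF refl]) (use assms(1,4) calculation in auto)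
  ultimately show ?thesis
    using assms(2-4) unfolding feasible_schedule_def arcs
    by (intro arg_cong2[of _ _ _ _ "(\<and>)"] ball_cong[OF refl]) simp_all
qed

lemma energy_cong:
  assumes "\<And>i. i \<in> tasks P \<Longrightarrow> task_speed S i = task_speed S' i"
  shows "energy P S = energy P S'"
  unfolding energy_def using assms by (intro sum.cong) simp_all

lemma sum_unary: "1 \<le> a \<Longrightarrow> a \<le> n \<Longrightarrow> (1::nat) + (\<Sum>c=1..n - 1. if c < a then 1 else 0) = a"
proof -
  assume "1 \<le> a" "a \<le> n"
  then have "{1..n - 1} \<inter> {c. c < a} = {1..<a}" by auto
  with \<open>1 \<le> a\<close> show ?thesis by (simp add: sum.If_cases)
qed

text \<open>Of the schedule only the start times are changed, and the energy does not depend on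
  them; hence equality of energies, not just an inequality.\<close>

lemma candidates_cover:
  assumes wf: "well_formed P" and feas: "feasible_schedule P S"
  shows "\<exists>X < 2 ^ (ntasks P * problem_size P).
    feasible_schedule P (candidate P X) \<and> energy P (candidate P X) = energy P S"
proof -
  let ?n = "ntasks P" and ?m = "ncores P" and ?k = "nspeeds P"
  obtain A where A: "\<And>i. i \<in> tasks P \<Longrightarrow> A i \<subseteq> tasks P"
    and feas': "feasible_schedule P (S\<lparr>task_start := \<lambda>i. \<Sum>j\<in>A i. weight P j / task_speed S j\<rparr>)"
    (is "feasible_schedule P ?S")
    using left_shifted_schedule[OF wf feas] by blast
  have "\<exists>l\<in>{1..?k}. task_speed S i = speed P l" if "i \<in> tasks P" for i
    using feas that by (auto simp: feasible_schedule_def)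
  then obtain l where l: "\<And>i. i \<in> tasks P \<Longrightarrow> l i \<in> {1..?k} \<and> task_speed S i = speed P (l i)"
    by metis
  have core: "task_core S i \<in> {1..?m}" if "i \<in> tasks P" for i
    using feas that by (auto simp: feasible_schedule_def)
  \<comment> \<open>The comparisons are strict, so a unary block has one 1 less than the index it
    stands for; \<open>decode\<close> adds it back. An index is thus at least 1 whatever the bits
    are.\<close>
  define f :: "nat \<Rightarrow> nat \<Rightarrow> nat" where "f i j =
    (if j \<le> ?n then if j \<in> A i then 1 else 0
     else if j \<le> ?n + ?m then if j - ?n < task_core S i then 1 else 0
     else if j - (?n + ?m) < l i then 1 else 0)" for i j
  have "f i j < 2" for i j by (simp add: f_def)
  then obtain X where X: "X < 2 ^ (?n * problem_size P)"
    "\<And>i j. i \<in> {1..?n} \<Longrightarrow> j \<in> {1..problem_size P} \<Longrightarrow> bits (problem_size P) X i j = f i j"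
    using ex_bits_matrix[of f ?n "problem_size P"] by blast
  let ?C = "candidate P X" and ?b = "bits (problem_size P) X"
  have speed: "task_speed ?C i = task_speed S i" if "i \<in> tasks P" for i
  proof -
    have "(\<Sum>j=1..?k - 1. ?b i (?n + ?m + j)) = (\<Sum>j=1..?k - 1. if j < l i then 1 else 0)"
      by (rule sum.cong[OF refl], subst X(2)) (use that in \<open>auto simp: problem_size_def f_def\<close>)
    then have "1 + (\<Sum>j=1..?k - 1. ?b i (?n + ?m + j)) = l i"
      using sum_unary[of "l i" ?k] l[OF that] by simp
    with l[OF that] show ?thesis by (simp add: candidate_def decode_def Let_def)
  qed
  have "task_core ?C i = task_core S i" if "i \<in> tasks P" for i
  proof -
    have "(\<Sum>j=1..?m - 1. ?b i (?n + j)) = (\<Sum>j=1..?m - 1. if j < task_core S i then 1 else 0)"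
      by (rule sum.cong[OF refl], subst X(2)) (use that in \<open>auto simp: problem_size_def f_def\<close>)
    then show ?thesis
      using sum_unary[of "task_core S i" ?m] core[OF that]
      by (simp add: candidate_def decode_def Let_def)
  qed
  moreover have "task_start ?C i = (\<Sum>j\<in>A i. weight P j / task_speed S j)" if "i \<in> tasks P" for i
  proof -
    have "task_start ?C i = (\<Sum>j=1..?n. real (?b i j) * (weight P j / task_speed ?C j))"
      by (simp add: candidate_def decode_def Let_def)
    also have "\<dots> = (\<Sum>j=1..?n. if j \<in> A i then weight P j / task_speed S j else 0)"
      by (rule sum.cong[OF refl], subst X(2)) (use that speed in \<open>auto simp: problem_size_def f_def\<close>)
    also have "\<dots> = (\<Sum>j\<in>A i. weight P j / task_speed S j)"
      using A[OF that] by (simp add: sum.If_cases Int_absorb1)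
    finally show ?thesis .
  qed
  ultimately have "feasible_schedule P ?C"
    using feas' feasible_schedule_cong[of P ?C ?S] speed wf by (simp add: well_formed_def)
  moreover have "energy P ?C = energy P S"
    using speed by (rule energy_cong)
  ultimately show ?thesis using X(1) by blast
qed

text \<open>Every energy of a feasible schedule is also the energy of a feasible candidate, so
  comparison with candidates suffices.\<close>

lemma optimal_candidateI:
  assumes "well_formed P" "feasible_schedule P (candidate P X)"
    and "\<And>Y. Y < 2 ^ (ntasks P * problem_size P) \<Longrightarrow> feasible_schedule P (candidate P Y) \<Longrightarrow>
      energy P (candidate P X) \<le> energy P (candidate P Y)"
  shows "optimal_schedule P (candidate P X)"
  unfolding optimal_schedule_def
proof (intro conjI allI impI)
  fix S assume "feasible_schedule P S"
  then obtain Y where "Y < 2 ^ (ntasks P * problem_size P)" "feasible_schedule P (candidate P Y)"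
    "energy P (candidate P Y) = energy P S"
    using candidates_cover[OF assms(1)] by blast
  with assms(3)[of Y] show "energy P (candidate P X) \<le> energy P S" by simp
qed (fact assms(2))

lemma ex_optimal_schedule:
  assumes wf: "well_formed P" and "feasible_schedule P S"
  shows "\<exists>S. optimal_schedule P S"
proof -
  let ?F = "{X. X < 2 ^ (ntasks P * problem_size P) \<and> feasible_schedule P (candidate P X)}"
  have "finite ?F" "?F \<noteq> {}" using candidates_cover[OF assms] by auto
  then have "arg_min_on (\<lambda>X. energy P (candidate P X)) ?F \<in> ?F"
    "Y \<in> ?F \<Longrightarrow> energy P (candidate P (arg_min_on (\<lambda>X. energy P (candidate P X)) ?F))
      \<le> energy P (candidate P Y)" for Y
    by (rule arg_min_if_finite(1), rule arg_min_least)
  then obtain X where "X \<in> ?F" "\<And>Y. Y \<in> ?F \<Longrightarrow> energy P (candidate P X) \<le> energy P (candidate P Y)"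
    by blast
  then show ?thesis
    using optimal_candidateI[OF wf, of X] by (intro exI[of _ "candidate P X"]) simp
qed

section \<open>Programs and their running time\<close>

primrec writes :: "com \<Rightarrow> string set" where
  "writes Skip = {}"
| "writes (NAssign a p q u) = {a}"
| "writes (RAssign a p q u) = {a}"
| "writes (Seq c d) = writes c \<union> writes d"
| "writes (If b c d) = writes c \<union> writes d"
| "writes (While b c) = writes c"

text \<open>A frame condition. One name in \<open>W\<close> stands for the natural and the real
  array of that name.\<close>

definition agree :: "string set \<Rightarrow> memory \<Rightarrow> memory \<Rightarrow> bool" where
  "agree W s s' \<longleftrightarrow> (\<forall>a. a \<notin> W \<longrightarrow> nats s' a = nats s a \<and> reals s' a = reals s a)"

lemma agree_refl: "agree W s s"
  by (simp add: agree_def)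

lemma agree_trans: "agree W s s' \<Longrightarrow> agree W' s' s'' \<Longrightarrow> agree (W \<union> W') s s''"
  by (simp add: agree_def)

lemma agreeD:
  "agree W s s' \<Longrightarrow> a \<notin> W \<Longrightarrow> nats s' a = nats s a"
  "agree W s s' \<Longrightarrow> a \<notin> W \<Longrightarrow> reals s' a = reals s a"
  by (simp_all add: agree_def)

lemma exec_agree: "exec c s t s' \<Longrightarrow> agree (writes c) s s'"
  by (induction rule: exec.induct) (auto simp: agree_def update_def)

text \<open>Total correctness with a time budget. An upper bound replaces the exact running time so
  that branches of different cost can share one budget.\<close>

definition runs :: "com \<Rightarrow> memory \<Rightarrow> nat \<Rightarrow> (memory \<Rightarrow> bool) \<Rightarrow> bool" where
  "runs c s T Q \<longleftrightarrow> (\<exists>t s'. exec c s t s' \<and> t \<le> T \<and> Q s')"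

lemma runs_mono:
  assumes "runs c s T Q" "T \<le> T'" "\<And>s'. Q s' \<Longrightarrow> agree (writes c) s s' \<Longrightarrow> Q' s'"
  shows "runs c s T' Q'"
  using assms exec_agree unfolding runs_def by (meson order_trans)

lemma runs_Skip: "Q s \<Longrightarrow> runs Skip s T Q"
  unfolding runs_def using exec.Skip by blast

lemma runs_NAssign:
  "Q (s\<lparr>nats := update (nats s) a (nval p s) (nval q s) (nval u s)\<rparr>) \<Longrightarrow> 1 \<le> T \<Longrightarrow> runs (NAssign a p q u) s T Q"
  unfolding runs_def using exec.NAssign by blast

lemma runs_RAssign:
  "Q (s\<lparr>reals := update (reals s) a (nval p s) (nval q s) (rval u s)\<rparr>) \<Longrightarrow> 1 \<le> T \<Longrightarrow> runs (RAssign a p q u) s T Q"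
  unfolding runs_def using exec.RAssign by blast

text \<open>The frame of \<open>c\<close> is handed on together with its postcondition, so
  postconditions need to speak only of what has changed.\<close>

lemma runs_Seq:
  assumes "runs c s U R" "\<And>s'. R s' \<Longrightarrow> agree (writes c) s s' \<Longrightarrow> runs d s' V Q" "U + V \<le> T"
  shows "runs (Seq c d) s T Q"
proof -
  from assms(1) obtain t1 s1 where 1: "exec c s t1 s1" "t1 \<le> U" "R s1"
    by (auto simp: runs_def)
  with assms(2) obtain t2 s2 where "exec d s1 t2 s2" "t2 \<le> V" "Q s2"
    using exec_agree unfolding runs_def by blast
  with 1 assms(3) exec.Seq[OF 1(1)] show ?thesis
    unfolding runs_def by (meson add_mono order_trans)
qed

lemma runs_NAssign_Seq:
  assumes "runs d (s\<lparr>nats := update (nats s) a (nval p s) (nval q s) (nval u s)\<rparr>) T Q" "T + 1 \<le> T'"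
  shows "runs (Seq (NAssign a p q u) d) s T' Q"
  by (rule runs_Seq[OF runs_NAssign[where T=1 and Q="(=) (s\<lparr>nats := update (nats s) a (nval p s) (nval q s) (nval u s)\<rparr>)"]])
    (use assms in auto)

lemma runs_RAssign_Seq:
  assumes "runs d (s\<lparr>reals := update (reals s) a (nval p s) (nval q s) (rval u s)\<rparr>) T Q" "T + 1 \<le> T'"
  shows "runs (Seq (RAssign a p q u) d) s T' Q"
  by (rule runs_Seq[OF runs_RAssign[where T=1 and Q="(=) (s\<lparr>reals := update (reals s) a (nval p s) (nval q s) (rval u s)\<rparr>)"]])
    (use assms in auto)

lemma runs_If:
  assumes "bval b s \<Longrightarrow> runs c s T Q" "\<not> bval b s \<Longrightarrow> runs d s T Q"
    and "T + 1 \<le> T'"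
  shows "runs (If b c d) s T' Q"
proof (cases "bval b s")
  case True
  with assms(1) obtain t s' where "exec c s t s'" "t \<le> T" "Q s'" by (auto simp: runs_def)
  with assms(3) show ?thesis
    using exec.IfTrue[OF True] unfolding runs_def by (metis add.commute add_le_mono1 order_trans)
next
  case False
  with assms(2) obtain t s' where "exec d s t s'" "t \<le> T" "Q s'" by (auto simp: runs_def)
  with assms(3) show ?thesis
    using exec.IfFalse[OF False] unfolding runs_def by (metis add.commute add_le_mono1 order_trans)
qed

abbreviation nvar :: "string \<Rightarrow> nexp" where
  "nvar a \<equiv> NRead a (NConst 0) (NConst 0)"

abbreviation rvar :: "string \<Rightarrow> rexp" where
  "rvar a \<equiv> RRead a (NConst 0) (NConst 0)"

abbreviation nset :: "string \<Rightarrow> nexp \<Rightarrow> com" where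
  "nset a \<equiv> NAssign a (NConst 0) (NConst 0)"

abbreviation rset :: "string \<Rightarrow> rexp \<Rightarrow> com" where
  "rset a \<equiv> RAssign a (NConst 0) (NConst 0)"

text \<open>The counter starts at 1 as the numbering of tasks does. The bound is evaluated anew in
  every round, so reasoning about the loop requires its value to be unaffected by the body and the
  counter.\<close>

definition For :: "string \<Rightarrow> nexp \<Rightarrow> com \<Rightarrow> com" where
  "For a hi c = Seq (nset a (NConst 1))
     (While (BNot (NLess hi (nvar a))) (Seq c (nset a (NAdd (nvar a) (NConst 1)))))"

lemma writes_For [simp]: "writes (For a hi c) = insert a (writes c)"
  by (auto simp: For_def)

text \<open>\<open>I j\<close> describes the memory after \<open>j\<close> rounds.\<close>

lemma runs_For:
  assumes a: "a \<notin> writes c" and H: "H \<le> Z"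
    and hi: "\<And>s'. agree (insert a (writes c)) s s' \<Longrightarrow> nval hi s' = H"
    and base: "I 0 s"
    and indep: "\<And>j s' v. I j s' \<Longrightarrow> I j (s'\<lparr>nats := update (nats s') a 0 0 v\<rparr>)"
    and step: "\<And>j s'. j < H \<Longrightarrow> agree (insert a (writes c)) s s' \<Longrightarrow> nats s' a 0 0 = Suc j \<Longrightarrow>
      I j s' \<Longrightarrow> runs c s' T (I (Suc j))"
  shows "runs (For a hi c) s (Z * (T + 2) + 2) (I H)"
proof -
  let ?W = "insert a (writes c)"
  let ?w = "While (BNot (NLess hi (nvar a))) (Seq c (nset a (NAdd (nvar a) (NConst 1))))"
  have upd: "agree ?W s (s'\<lparr>nats := update (nats s') a 0 0 v\<rparr>)" if "agree ?W s s'" for s' v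
    using that by (auto simp: agree_def update_def)
  \<comment> \<open>A round costs \<open>T + 2\<close>: guard, body and increment. The failing guard
    costs 1, and the initialization outside this loop another 1. Replacing \<open>H\<close> by
    \<open>Z\<close> at the end makes all budgets depend on the problem size alone.\<close>
  have loop: "runs ?w s' ((H - j) * (T + 2) + 1) (I H)"
    if "j \<le> H" "agree ?W s s'" "nats s' a 0 0 = Suc j" "I j s'" for j s'
    using that
  proof (induction "H - j" arbitrary: j s')
    case 0
    then have "I H s'" "\<not> bval (BNot (NLess hi (nvar a))) s'"
      by (auto simp: hi)
    then show ?case
      unfolding runs_def using exec.WhileFalse by (metis le_add2)
  next
    case (Suc k)
    then have j: "j < H" and guard: "bval (BNot (NLess hi (nvar a))) s'"
      by (auto simp: hi)
    from step[OF j Suc.prems(2-4)] obtain t1 s1 where 1: "exec c s' t1 s1" "t1 \<le> T" "I (Suc j) s1"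
      by (auto simp: runs_def)
    from exec_agree[OF 1(1)] have frame: "agree (writes c) s' s1" .
    let ?s2 = "s1\<lparr>nats := update (nats s1) a 0 0 (Suc (Suc j))\<rparr>"
    have "nats s1 a 0 0 = Suc j"
      using agreeD(1)[OF frame a] Suc.prems(3) by simp
    with exec.NAssign[of a "NConst 0" "NConst 0" "NAdd (nvar a) (NConst 1)" s1]
    have 2: "exec (nset a (NAdd (nvar a) (NConst 1))) s1 1 ?s2"
      by simp
    have "agree ?W s s1"
      using agree_trans[OF Suc.prems(2) frame] by (simp add: insert_absorb Un_absorb)
    then have "runs ?w ?s2 ((H - Suc j) * (T + 2) + 1) (I H)"
      using Suc.hyps(2) j 1(3)
      by (intro Suc.hyps(1) upd indep) (auto simp: update_def)
    then obtain t3 s3 where 3: "exec ?w ?s2 t3 s3" "t3 \<le> (H - Suc j) * (T + 2) + 1" "I H s3"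
      by (auto simp: runs_def)
    have "exec ?w s' (1 + (t1 + 1) + t3) s3"
      using exec.WhileTrue[OF guard exec.Seq[OF 1(1) 2] 3(1)] .
    moreover have "H - j = Suc (H - Suc j)" using j by simp
    then have "1 + (t1 + 1) + t3 \<le> (H - j) * (T + 2) + 1"
      using 1(2) 3(2) by simp
    ultimately show ?case
      using 3(3) unfolding runs_def by blast
  qed
  have "runs ?w (s\<lparr>nats := update (nats s) a 0 0 1\<rparr>) (H * (T + 2) + 1) (I H)"
    using loop[of 0] upd[OF agree_refl] indep[OF base] by (simp add: update_def)
  moreover have "H * (T + 2) \<le> Z * (T + 2)"
    using H by (rule mult_le_mono1)
  ultimately show ?thesis
    unfolding For_def by (intro runs_NAssign_Seq[where T="H * (T + 2) + 1"]) simp_all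
qed

section \<open>Exhaustive search\<close>

definition inputs :: "string set" where
  "inputs = {''n'', ''m'', ''k'', ''E'', ''D'', ''alpha'', ''w'', ''v''}"

text \<open>States that the input arrays are intact. The complement appears because
  \<open>agree\<close> names what may have changed.\<close>

definition loaded :: "problem \<Rightarrow> memory \<Rightarrow> bool" where
  "loaded P s \<longleftrightarrow> agree (- inputs) (input_memory P) s"

lemma loaded_agree: "loaded P s \<Longrightarrow> agree W s s' \<Longrightarrow> W \<inter> inputs = {} \<Longrightarrow> loaded P s'"
  unfolding loaded_def agree_def by auto

lemma loadedD:
  assumes "loaded P s"
  shows "nats s ''n'' 0 0 = ntasks P" "nats s ''m'' 0 0 = ncores P" "nats s ''k'' 0 0 = nspeeds P"
    "nats s ''E'' i j = (if (i, j) \<in> arcs P then 1 else 0)"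
    "reals s ''D'' 0 0 = deadline P" "reals s ''alpha'' 0 0 = alpha P"
    "i \<in> tasks P \<Longrightarrow> reals s ''w'' i 0 = weight P i"
    "l \<in> {1..nspeeds P} \<Longrightarrow> reals s ''v'' l 0 = speed P l"
  using assms by (auto simp: loaded_def agree_def inputs_def input_memory_def)

section \<open>Counting and decoding the candidates\<close>

abbreviation row_length :: nexp where
  "row_length \<equiv> NAdd (nvar ''n'') (NAdd (nvar ''m'') (nvar ''k''))"

text \<open>With addition as the only means of enlarging a natural number, the number of candidates
  is reached by one doubling for each cell of the matrix.\<close>

definition set_limit :: com where
  "set_limit = Seq (nset ''L'' (NConst 1))
     (For ''i'' (nvar ''n'') (For ''j'' row_length (nset ''L'' (NAdd (nvar ''L'') (nvar ''L'')))))"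

lemma writes_set_limit: "writes set_limit = {''L'', ''i'', ''j''}"
  by (auto simp: set_limit_def)

lemma runs_set_limit:
  assumes "loaded P s" and Z: "problem_size P = Z"
  shows "runs set_limit s (Z * (Z * 3 + 4) + 3) (\<lambda>s'. nats s' ''L'' 0 0 = 2 ^ (ntasks P * Z))"
  unfolding set_limit_def
proof (rule runs_NAssign_Seq)
  let ?s = "s\<lparr>nats := update (nats s) ''L'' (nval (NConst 0) s) (nval (NConst 0) s) (nval (NConst 1) s)\<rparr>"
  have ld: "loaded P ?s"
    by (rule loaded_agree[OF assms(1), of "{''L''}"]) (auto simp: agree_def update_def inputs_def)
  have inner: "runs (For ''j'' row_length (nset ''L'' (NAdd (nvar ''L'') (nvar ''L'')))) s'
      (Z * (1 + 2) + 2) (\<lambda>s''. nats s'' ''L'' 0 0 = 2 ^ (i * Z + Z))"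
    if "loaded P s'" "nats s' ''L'' 0 0 = 2 ^ (i * Z)" for s' i
  proof (rule runs_For[where I="\<lambda>j s. nats s ''L'' 0 0 = 2 ^ (i * Z + j)"])
    fix s'' assume "agree (insert ''j'' (writes (nset ''L'' (NAdd (nvar ''L'') (nvar ''L''))))) s' s''"
    with that have "loaded P s''"
      by (elim loaded_agree) (auto simp: inputs_def)
    then show "nval row_length s'' = Z"
      using Z by (simp add: loadedD problem_size_def)
  qed (use that in \<open>auto simp: update_def intro!: runs_NAssign\<close>)
  have "runs (For ''i'' (nvar ''n'') (For ''j'' row_length (nset ''L'' (NAdd (nvar ''L'') (nvar ''L''))))) ?s
      (Z * (Z * (1 + 2) + 2 + 2) + 2) (\<lambda>s. nats s ''L'' 0 0 = 2 ^ (ntasks P * Z))"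
  proof (rule runs_For[where I="\<lambda>i s. nats s ''L'' 0 0 = 2 ^ (i * Z)"])
    fix s' assume "agree (insert ''i'' (writes (For ''j'' row_length (nset ''L'' (NAdd (nvar ''L'') (nvar ''L'')))))) ?s s'"
    then have ld': "loaded P s'"
      by (rule loaded_agree[OF ld]) (auto simp: inputs_def)
    then show "nval (nvar ''n'') s' = ntasks P"
      by (simp add: loadedD)
    fix i assume "nats s' ''L'' 0 0 = 2 ^ (i * Z)"
    from inner[OF ld' this]
    show "runs (For ''j'' row_length (nset ''L'' (NAdd (nvar ''L'') (nvar ''L'')))) s'
      (Z * (1 + 2) + 2) (\<lambda>s''. nats s'' ''L'' 0 0 = 2 ^ (Suc i * Z))"
      by (simp add: add.commute)
  qed (use Z in \<open>auto simp: update_def problem_size_def\<close>)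
  then show "runs (For ''i'' (nvar ''n'') (For ''j'' row_length (nset ''L'' (NAdd (nvar ''L'') (nvar ''L''))))) ?s
      (Z * (Z * 3 + 4) + 2) (\<lambda>s. nats s ''L'' 0 0 = 2 ^ (ntasks P * Z))"
    by (rule runs_mono) (simp_all add: algebra_simps)
qed simp

definition read_bit :: com where
  "read_bit = Seq (nset ''q'' (NConst 0))
     (Seq (For ''t'' (nvar ''y'') (nset ''q'' (NSub (nvar ''t'') (nvar ''q''))))
     (Seq (NAssign ''B'' (nvar ''i'') (nvar ''j'') (NSub (NAdd (nvar ''q'') (nvar ''q'')) (nvar ''y'')))
     (nset ''y'' (NSub (nvar ''y'') (nvar ''q'')))))"

lemma writes_read_bit: "writes read_bit = {''q'', ''t'', ''B'', ''y''}"
  by (auto simp: read_bit_def)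

text \<open>Without division, half of \<open>y\<close> is found by iterating \<open>q := t - q\<close> for \<open>t = 1, \<dots>, y\<close>,
  which yields \<open>\<lceil>y / 2\<rceil>\<close>.\<close>

lemma runs_read_bit:
  assumes "nats s ''y'' 0 0 = y" "nats s ''i'' 0 0 = i" "nats s ''j'' 0 0 = j" "y \<le> M"
  shows "runs read_bit s (M * 3 + 5) (\<lambda>s'. nats s' ''y'' 0 0 = y div 2 \<and>
    nats s' ''B'' = (nats s ''B'')(i := (nats s ''B'' i)(j := y mod 2)))"
  unfolding read_bit_def
proof (rule runs_NAssign_Seq[where T="M * 3 + 4"], rule runs_Seq)
  let ?s = "s\<lparr>nats := update (nats s) ''q'' (nval (NConst 0) s) (nval (NConst 0) s) (nval (NConst 0) s)\<rparr>"
  show "runs (For ''t'' (nvar ''y'') (nset ''q'' (NSub (nvar ''t'') (nvar ''q'')))) ?s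
      (M * (1 + 2) + 2) (\<lambda>s. nats s ''q'' 0 0 = (y + 1) div 2)"
  proof (rule runs_For[where I="\<lambda>t (s :: memory). nats s ''q'' 0 0 = (t + 1) div 2"])
    \<comment> \<open>The halves of \<open>t\<close> and \<open>t + 1\<close>, both rounded up, add
      to \<open>t + 1\<close>, so the truncated subtraction is exact.\<close>
    fix t and s' :: memory assume "nats s' ''t'' 0 0 = Suc t" "nats s' ''q'' 0 0 = (t + 1) div 2"
    then show "runs (nset ''q'' (NSub (nvar ''t'') (nvar ''q''))) s' 1
        (\<lambda>s. nats s ''q'' 0 0 = (Suc t + 1) div 2)"
      by (intro runs_NAssign) (simp add: update_def, presburger)
  qed (use assms in \<open>auto simp: update_def agree_def\<close>)
next
  let ?s = "s\<lparr>nats := update (nats s) ''q'' (nval (NConst 0) s) (nval (NConst 0) s) (nval (NConst 0) s)\<rparr>"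
  fix s' assume q: "nats s' ''q'' 0 0 = (y + 1) div 2"
    and frame: "agree (writes (For ''t'' (nvar ''y'') (nset ''q'' (NSub (nvar ''t'') (nvar ''q''))))) ?s s'"
  have same: "nats s' ''y'' = nats s ''y''" "nats s' ''i'' = nats s ''i''" "nats s' ''j'' = nats s ''j''"
    "nats s' ''B'' = nats s ''B''"
    using frame by (simp_all add: agree_def update_def)
  \<comment> \<open>Rounding up keeps both differences nonnegative: the first is half of
    \<open>y\<close> rounded down, the second the parity of \<open>y\<close>.\<close>
  have "y - (y + 1) div 2 = y div 2" "(y + 1) div 2 + (y + 1) div 2 - y = y mod 2"
    by presburger+
  then show "runs (Seq (NAssign ''B'' (nvar ''i'') (nvar ''j'') (NSub (NAdd (nvar ''q'') (nvar ''q'')) (nvar ''y'')))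
     (nset ''y'' (NSub (nvar ''y'') (nvar ''q'')))) s' 2 (\<lambda>s'. nats s' ''y'' 0 0 = y div 2 \<and>
    nats s' ''B'' = (nats s ''B'')(i := (nats s ''B'' i)(j := y mod 2)))"
    using assms same q
    by (intro runs_NAssign_Seq[where T=1] runs_NAssign) (simp_all add: update_def)
qed simp_all

text \<open>The loop counter \<open>x\<close> begins at 1, the candidates at 0; hence the
  subtraction.\<close>

definition read_bits :: com where
  "read_bits = Seq (nset ''y'' (NSub (nvar ''x'') (NConst 1)))
     (For ''i'' (nvar ''n'') (For ''j'' row_length read_bit))"

lemma writes_read_bits: "writes read_bits = {''q'', ''t'', ''B'', ''y'', ''i'', ''j''}"
  by (auto simp: read_bits_def writes_read_bit)

text \<open>The factor \<open>M\<close> is the price of halving by counting: each bit takes time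
  linear in the number still to be decoded. The bound \<open>M\<close> will be exponential, as is
  the number of candidates.\<close>

lemma runs_read_bits:
  assumes "loaded P s" and Z: "problem_size P = Z" and X: "nats s ''x'' 0 0 - 1 = X" "X \<le> M"
  shows "runs read_bits s (Z * (Z * (M * 3 + 7) + 4) + 3)
    (\<lambda>s'. \<forall>i\<in>tasks P. \<forall>j\<in>{1..Z}. nats s' ''B'' i j = bits Z X i j)"
  unfolding read_bits_def
proof (rule runs_NAssign_Seq)
  let ?s = "s\<lparr>nats := update (nats s) ''y'' (nval (NConst 0) s) (nval (NConst 0) s)
    (nval (NSub (nvar ''x'') (NConst 1)) s)\<rparr>"
  \<comment> \<open>After \<open>p\<close> halvings the first \<open>p\<close> cells in row-major
    order are final, and \<open>y\<close> holds the bits still to come.\<close>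
  define J where "J p s \<longleftrightarrow> nats s ''y'' 0 0 = X div 2 ^ p \<and>
    (\<forall>i\<in>tasks P. \<forall>j\<in>{1..Z}. (i - 1) * Z + (j - 1) < p \<longrightarrow> nats s ''B'' i j = bits Z X i j)" for p and s :: memory
  have ld: "loaded P ?s"
    by (rule loaded_agree[OF assms(1), of "{''y''}"]) (auto simp: agree_def update_def inputs_def)
  have inner: "runs (For ''j'' row_length read_bit) s' (Z * (M * 3 + 5 + 2) + 2) (J (i * Z + Z))"
    if ld': "loaded P s'" and J: "J (i * Z) s'" and i: "nats s' ''i'' 0 0 = Suc i" for s' i
  proof (rule runs_For[where I="\<lambda>j. J (i * Z + j)"])
    fix s'' assume frame: "agree (insert ''j'' (writes read_bit)) s' s''"
    with ld' have "loaded P s''"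
      by (elim loaded_agree) (auto simp: inputs_def writes_read_bit)
    then show "nval row_length s'' = Z"
      using Z by (simp add: loadedD problem_size_def)
    fix j assume j: "j < Z" "nats s'' ''j'' 0 0 = Suc j" and J': "J (i * Z + j) s''"
    let ?y = "X div 2 ^ (i * Z + j)"
    have "nats s'' ''i'' 0 0 = Suc i"
      using frame i by (simp add: agree_def writes_read_bit)
    moreover have "nats s'' ''y'' 0 0 = ?y" using J' by (simp add: J_def)
    moreover have "?y \<le> M" using X(2) div_le_dividend order_trans by blast
    ultimately have "runs read_bit s'' (M * 3 + 5) (\<lambda>s'. nats s' ''y'' 0 0 = ?y div 2 \<and>
        nats s' ''B'' = (nats s'' ''B'')(Suc i := (nats s'' ''B'' (Suc i))(Suc j := ?y mod 2)))"
      using j(2) by (intro runs_read_bit)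
    then show "runs read_bit s'' (M * 3 + 5) (J (i * Z + Suc j))"
    proof (rule runs_mono)
      fix s3 :: memory assume s3: "nats s3 ''y'' 0 0 = ?y div 2 \<and>
        nats s3 ''B'' = (nats s'' ''B'')(Suc i := (nats s'' ''B'' (Suc i))(Suc j := ?y mod 2))"
      have "nats s3 ''B'' i' j' = bits Z X i' j'"
        if "i' \<in> tasks P" "j' \<in> {1..Z}" "(i' - 1) * Z + (j' - 1) < i * Z + Suc j" for i' j'
      proof (cases "i' = Suc i \<and> j' = Suc j")
        case True
        with s3 show ?thesis by (simp add: bits_def)
      next
        case False
        \<comment> \<open>Distinct cells have distinct positions. Any other cell below the new bound
          therefore lies below the old one, and its entry survives the write.\<close>
        with bit_index_inj[of i' "Suc i" j' Z "Suc j"] that j(1)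
        have "(i' - 1) * Z + (j' - 1) \<noteq> i * Z + j" by auto
        with that(3) have "(i' - 1) * Z + (j' - 1) < i * Z + j" by linarith
        with that J' have "nats s'' ''B'' i' j' = bits Z X i' j'"
          unfolding J_def by blast
        with s3 False show ?thesis by auto
      qed
      moreover have "nats s3 ''y'' 0 0 = X div 2 ^ (i * Z + Suc j)"
        using s3 by (simp add: mult.commute flip: div_mult2_eq)
      ultimately show "J (i * Z + Suc j) s3"
        unfolding J_def by blast
    qed simp
  qed (use J in \<open>auto simp: J_def update_def writes_read_bit\<close>)
  have "runs (For ''i'' (nvar ''n'') (For ''j'' row_length read_bit)) ?s
      (Z * (Z * (M * 3 + 5 + 2) + 2 + 2) + 2) (J (ntasks P * Z))"
  proof (rule runs_For[where I="\<lambda>i. J (i * Z)"])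
    fix s' assume "agree (insert ''i'' (writes (For ''j'' row_length read_bit))) ?s s'"
    then have ld': "loaded P s'"
      by (rule loaded_agree[OF ld]) (auto simp: inputs_def writes_read_bit)
    then show "nval (nvar ''n'') s' = ntasks P"
      by (simp add: loadedD)
    fix i assume "J (i * Z) s'" "nats s' ''i'' 0 0 = Suc i"
    from inner[OF ld' this]
    show "runs (For ''j'' row_length read_bit) s' (Z * (M * 3 + 5 + 2) + 2) (J (Suc i * Z))"
      by (simp add: add.commute)
  qed (use Z X in \<open>auto simp: update_def problem_size_def J_def writes_read_bit\<close>)
  then show "runs (For ''i'' (nvar ''n'') (For ''j'' row_length read_bit)) ?s
      (Z * (Z * (M * 3 + 7) + 4) + 2) (\<lambda>s'. \<forall>i\<in>tasks P. \<forall>j\<in>{1..Z}. nats s' ''B'' i j = bits Z X i j)"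
  proof (rule runs_mono)
    fix s' assume J: "J (ntasks P * Z) s'"
    have "(i - 1) * Z + (j - 1) < ntasks P * Z" if "i \<in> tasks P" "j \<in> {1..Z}" for i j
    proof -
      have "j - 1 < Z" using that by auto
      then have "(i - 1) * Z + (j - 1) < (i - 1) * Z + Z" by simp
      also have "\<dots> = i * Z" using that by (cases i) auto
      also have "\<dots> \<le> ntasks P * Z" using that by simp
      finally show ?thesis .
    qed
    with J show "\<forall>i\<in>tasks P. \<forall>j\<in>{1..Z}. nats s' ''B'' i j = bits Z X i j"
      unfolding J_def by blast
  qed (simp add: algebra_simps)
qed simp

definition read_machines :: com where
  "read_machines = For ''i'' (nvar ''n'')
     (Seq (NAssign ''core'' (nvar ''i'') (NConst 0) (NConst 1))
     (Seq (For ''j'' (NSub (nvar ''m'') (NConst 1))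
       (NAssign ''core'' (nvar ''i'') (NConst 0) (NAdd (NRead ''core'' (nvar ''i'') (NConst 0))
         (NRead ''B'' (nvar ''i'') (NAdd (nvar ''n'') (nvar ''j''))))))
     (Seq (nset ''l'' (NConst 1))
     (Seq (For ''j'' (NSub (nvar ''k'') (NConst 1))
       (nset ''l'' (NAdd (nvar ''l'')
         (NRead ''B'' (nvar ''i'') (NAdd (NAdd (nvar ''n'') (nvar ''m'')) (nvar ''j''))))))
     (RAssign ''speed'' (nvar ''i'') (NConst 0) (RRead ''v'' (nvar ''l'') (NConst 0)))))))"

lemma writes_read_machines: "writes read_machines = {''i'', ''j'', ''core'', ''l'', ''speed''}"
  by (auto simp: read_machines_def)

lemma candidate_sel:
  "task_speed (candidate P X) i =
     speed P (1 + (\<Sum>l=1..nspeeds P - 1. bits (problem_size P) X i (ntasks P + ncores P + l)))"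
  "task_core (candidate P X) i = 1 + (\<Sum>c=1..ncores P - 1. bits (problem_size P) X i (ntasks P + c))"
  "task_start (candidate P X) i = (\<Sum>j=1..ntasks P.
     real (bits (problem_size P) X i j) * (weight P j / task_speed (candidate P X) j))"
  by (simp_all add: candidate_def decode_def Let_def)

text \<open>The benefit of unary coding: every bit pattern decodes to a legal core and a legal speed
  index, so no candidate is malformed.\<close>

lemma sum_bits_less:
  assumes "1 \<le> n"
  shows "1 + (\<Sum>j=1..n - 1. bits K X i (h + j)) \<in> {1..n}"
proof -
  have "(\<Sum>j=1..n - 1. bits K X i (h + j)) \<le> (\<Sum>j=1..n - 1. 1)"
    by (intro sum_mono bits_le_1)
  with assms show ?thesis by simp
qed

lemma runs_read_machines:
  assumes wf: "well_formed P" and ld: "loaded P s" and Z: "problem_size P = Z"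
    and B: "\<forall>i\<in>tasks P. \<forall>j\<in>{1..Z}. nats s ''B'' i j = bits Z X i j"
  shows "runs read_machines s (Z * (Z * 6 + 9) + 2) (\<lambda>s'. \<forall>i\<in>tasks P.
    nats s' ''core'' i 0 = task_core (candidate P X) i \<and>
    reals s' ''speed'' i 0 = task_speed (candidate P X) i)"
proof -
  let ?C = "candidate P X"
  let ?core = "\<lambda>i j. 1 + (\<Sum>c=1..j. bits Z X i (ntasks P + c))"
  let ?l = "\<lambda>i j. 1 + (\<Sum>l=1..j. bits Z X i (ntasks P + ncores P + l))"
  let ?done = "\<lambda>r (s' :: memory). \<forall>i\<in>{1..r}. nats s' ''core'' i 0 = task_core ?C i \<and>
    reals s' ''speed'' i 0 = task_speed ?C i"
  have size: "1 \<le> ncores P" "1 \<le> nspeeds P"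
    using wf by (simp_all add: well_formed_def)
  have "runs read_machines s (Z * (Z * 6 + 7 + 2) + 2) (?done (ntasks P))"
    unfolding read_machines_def
  proof (rule runs_For[where I="?done"], goal_cases)
    case (3 s')
    then have "loaded P s'" using ld by (elim loaded_agree) (auto simp: inputs_def)
    then show ?case by (simp add: loadedD)
  next
    case (6 r s1)
    define i where "i = Suc r"
    have i: "i \<in> tasks P" "nats s1 ''i'' 0 0 = i" using 6(1,3) by (simp_all add: i_def)
    have ld1: "loaded P s1" using ld 6(2) by (elim loaded_agree) (auto simp: inputs_def)
    have B1: "nats s1 ''B'' = nats s ''B''" using 6(2) by (simp add: agree_def)
    let ?s2 = "s1\<lparr>nats := update (nats s1) ''core''
      (nval (nvar ''i'') s1) (nval (NConst 0) s1) (nval (NConst 1) s1)\<rparr>"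
    have fr2: "agree {''core''} s1 ?s2" by (simp add: agree_def update_def)
    \<comment> \<open>The frame treats \<open>core\<close> as a single array, so the survival of the
      entries of other tasks has to be part of the invariant.\<close>
    have core: "runs (For ''j'' (NSub (nvar ''m'') (NConst 1))
       (NAssign ''core'' (nvar ''i'') (NConst 0) (NAdd (NRead ''core'' (nvar ''i'') (NConst 0))
         (NRead ''B'' (nvar ''i'') (NAdd (nvar ''n'') (nvar ''j'')))))) ?s2 (Z * (1 + 2) + 2)
      (\<lambda>s. nats s ''core'' i 0 = ?core i (ncores P - 1) \<and> (\<forall>h. h \<noteq> i \<longrightarrow> nats s ''core'' h 0 = nats s1 ''core'' h 0))"
    proof (rule runs_For[where I="\<lambda>j (s :: memory). nats s ''core'' i 0 = ?core i j \<and>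
          (\<forall>h. h \<noteq> i \<longrightarrow> nats s ''core'' h 0 = nats s1 ''core'' h 0)"], goal_cases)
      case (3 s')
      then have "loaded P s'" using ld1 agree_trans[OF fr2] by (elim loaded_agree) (auto simp: inputs_def)
      then show ?case by (simp add: loadedD)
    next
      case (6 j s')
      from agree_trans[OF fr2 6(2)] have fr: "agree {''core'', ''j''} s1 s'" by (simp add: agree_def)
      then have "loaded P s'" using ld1 by (elim loaded_agree) (auto simp: inputs_def)
      moreover have "nats s' ''i'' 0 0 = i" "nats s' ''B'' = nats s ''B''"
        using fr i B1 by (simp_all add: agree_def)
      moreover have "nats s ''B'' i (ntasks P + Suc j) = bits Z X i (ntasks P + Suc j)"
        using B i(1) 6(1) Z by (auto simp: problem_size_def)
      ultimately show ?case
        using 6(3,4) by (intro runs_NAssign) (auto simp: update_def loadedD)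
    qed (use Z i(2) in \<open>auto simp: update_def problem_size_def\<close>)
    have speed: "runs (Seq (nset ''l'' (NConst 1))
       (Seq (For ''j'' (NSub (nvar ''k'') (NConst 1))
         (nset ''l'' (NAdd (nvar ''l'')
           (NRead ''B'' (nvar ''i'') (NAdd (NAdd (nvar ''n'') (nvar ''m'')) (nvar ''j''))))))
       (RAssign ''speed'' (nvar ''i'') (NConst 0) (RRead ''v'' (nvar ''l'') (NConst 0))))) s3
      (Z * 3 + 4) (?done (Suc r))"
      if fr3: "agree {''core'', ''j''} s1 s3"
        and core3: "nats s3 ''core'' i 0 = ?core i (ncores P - 1)"
          "\<forall>h. h \<noteq> i \<longrightarrow> nats s3 ''core'' h 0 = nats s1 ''core'' h 0" for s3
    proof -
      let ?s4 = "s3\<lparr>nats := update (nats s3) ''l'' (nval (NConst 0) s3) (nval (NConst 0) s3) (nval (NConst 1) s3)\<rparr>"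
      have fr4: "agree {''core'', ''j'', ''l''} s1 ?s4"
        using fr3 by (simp add: agree_def update_def)
      have loop: "runs (For ''j'' (NSub (nvar ''k'') (NConst 1))
         (nset ''l'' (NAdd (nvar ''l'')
           (NRead ''B'' (nvar ''i'') (NAdd (NAdd (nvar ''n'') (nvar ''m'')) (nvar ''j'')))))) ?s4
        (Z * (1 + 2) + 2) (\<lambda>s. nats s ''l'' 0 0 = ?l i (nspeeds P - 1))"
      proof (rule runs_For[where I="\<lambda>j (s :: memory). nats s ''l'' 0 0 = ?l i j" and T=1], goal_cases)
        case (3 s')
        then have "loaded P s'" using ld1 agree_trans[OF fr4] by (elim loaded_agree) (auto simp: inputs_def)
        then show ?case by (simp add: loadedD)
      next
        case (6 j s')
        from agree_trans[OF fr4 6(2)] have fr: "agree {''core'', ''j'', ''l''} s1 s'"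
          by (simp add: agree_def)
        then have "loaded P s'" using ld1 by (elim loaded_agree) (auto simp: inputs_def)
        moreover have "nats s' ''i'' 0 0 = i" "nats s' ''B'' = nats s ''B''"
          using fr i B1 by (simp_all add: agree_def)
        moreover have "nats s ''B'' i (ntasks P + ncores P + Suc j) = bits Z X i (ntasks P + ncores P + Suc j)"
          using B i(1) 6(1) Z by (auto simp: problem_size_def)
        ultimately show ?case
          using 6(3,4) by (intro runs_NAssign) (auto simp: update_def loadedD)
      qed (use Z in \<open>auto simp: update_def problem_size_def\<close>)
      show ?thesis
      proof (rule runs_NAssign_Seq[where T="Z * 3 + 3"], rule runs_Seq[where V=1, OF loop], goal_cases)
        case (1 s')
        have fr: "agree {''core'', ''j'', ''l''} s1 s'"
          using fr3 1(2) by (auto simp: agree_def update_def)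
        then have "loaded P s'" using ld1 by (elim loaded_agree) (auto simp: inputs_def)
        \<comment> \<open>The array \<open>v\<close> is known to hold speeds only at legal
          indices.\<close>
        moreover have "?l i (nspeeds P - 1) \<in> {1..nspeeds P}"
          using size(2) by (rule sum_bits_less)
        ultimately have v: "reals s' ''v'' (?l i (nspeeds P - 1)) 0 = task_speed ?C i"
          using loadedD(8) Z by (simp add: candidate_sel)
        have same: "nats s' ''i'' 0 0 = i" "reals s' ''speed'' = reals s1 ''speed''"
          using fr i by (simp_all add: agree_def)
        have core': "nats s' ''core'' = nats s3 ''core''"
          using 1(2) by (auto simp: agree_def update_def)
        show ?case
          using v same core' core3 1(1) 6(4) Z
          by (intro runs_RAssign[where T=1])
            (auto simp: update_def candidate_sel(2) atLeastAtMostSuc_conv i_def)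
      qed simp_all
    qed
    show ?case
    proof (rule runs_NAssign_Seq[where T="Z * 6 + 6"], rule runs_Seq[where V="Z * 3 + 4", OF core], goal_cases)
      case (1 s3)
      show ?case
      proof (rule speed)
        show "agree {''core'', ''j''} s1 s3"
          using 1(2) by (auto simp: agree_def update_def)
      qed (use 1(1) in auto)
    qed simp_all
  qed (use Z in \<open>auto simp: update_def problem_size_def\<close>)
  then show ?thesis by (rule runs_mono) auto
qed

text \<open>A separate pass, since the start of a task adds up durations of other tasks and so needs
  their speeds, including those of higher number.\<close>

definition set_starts :: com where
  "set_starts = For ''i'' (nvar ''n'')
     (Seq (RAssign ''start'' (nvar ''i'') (NConst 0) (ROfNat (NConst 0)))
     (For ''j'' (nvar ''n'')
       (RAssign ''start'' (nvar ''i'') (NConst 0) (RAdd (RRead ''start'' (nvar ''i'') (NConst 0))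
         (RMul (ROfNat (NRead ''B'' (nvar ''i'') (nvar ''j'')))
           (RDiv (RRead ''w'' (nvar ''j'') (NConst 0)) (RRead ''speed'' (nvar ''j'') (NConst 0))))))))"

lemma writes_set_starts: "writes set_starts = {''i'', ''j'', ''start''}"
  by (auto simp: set_starts_def)

lemma runs_set_starts:
  assumes ld: "loaded P s" and Z: "problem_size P = Z"
    and B: "\<forall>i\<in>tasks P. \<forall>j\<in>{1..Z}. nats s ''B'' i j = bits Z X i j"
    and speed: "\<forall>i\<in>tasks P. reals s ''speed'' i 0 = task_speed (candidate P X) i"
  shows "runs set_starts s (Z * (Z * 3 + 5) + 2)
    (\<lambda>s'. \<forall>i\<in>tasks P. reals s' ''start'' i 0 = task_start (candidate P X) i)"
proof -
  let ?C = "candidate P X"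
  let ?start = "\<lambda>i r. \<Sum>j=1..r. real (bits Z X i j) * (weight P j / task_speed ?C j)"
  let ?done = "\<lambda>r (s' :: memory). \<forall>i\<in>{1..r}. reals s' ''start'' i 0 = task_start ?C i"
  have "runs set_starts s (Z * (Z * 3 + 3 + 2) + 2) (?done (ntasks P))"
    unfolding set_starts_def
  proof (rule runs_For[where I="?done"], goal_cases)
    case (3 s')
    then have "loaded P s'" using ld by (elim loaded_agree) (auto simp: inputs_def)
    then show ?case by (simp add: loadedD)
  next
    case (6 r s1)
    define i where "i = Suc r"
    have i: "i \<in> tasks P" "nats s1 ''i'' 0 0 = i" using 6(1,3) by (simp_all add: i_def)
    let ?s2 = "s1\<lparr>reals := update (reals s1) ''start'' i 0 0\<rparr>"
    have fr2: "agree {''i'', ''j'', ''start''} s ?s2"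
      using 6(2) by (auto simp: agree_def update_def)
    have "runs (For ''j'' (nvar ''n'')
       (RAssign ''start'' (nvar ''i'') (NConst 0) (RAdd (RRead ''start'' (nvar ''i'') (NConst 0))
         (RMul (ROfNat (NRead ''B'' (nvar ''i'') (nvar ''j'')))
           (RDiv (RRead ''w'' (nvar ''j'') (NConst 0)) (RRead ''speed'' (nvar ''j'') (NConst 0))))))) ?s2
       (Z * (1 + 2) + 2) (\<lambda>s. reals s ''start'' i 0 = ?start i (ntasks P) \<and>
          (\<forall>h. h \<noteq> i \<longrightarrow> reals s ''start'' h 0 = reals s1 ''start'' h 0))"
    proof (rule runs_For[where I="\<lambda>j (s :: memory). reals s ''start'' i 0 = ?start i j \<and>
          (\<forall>h. h \<noteq> i \<longrightarrow> reals s ''start'' h 0 = reals s1 ''start'' h 0)"], goal_cases)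
      case (3 s')
      then have "loaded P s'" using ld agree_trans[OF fr2] by (elim loaded_agree) (auto simp: inputs_def)
      then show ?case by (simp add: loadedD)
    next
      case (6 j s')
      from agree_trans[OF fr2 6(2)] have fr: "agree {''i'', ''j'', ''start''} s s'"
        by (simp add: agree_def)
      then have "loaded P s'" using ld by (elim loaded_agree) (auto simp: inputs_def)
      moreover have "nats s' ''B'' = nats s ''B''" "reals s' ''speed'' = reals s ''speed''"
        using fr by (simp_all add: agree_def)
      moreover have "nats s' ''i'' 0 0 = i"
        using 6(2) i(2) by (simp add: agree_def)
      moreover have "nats s ''B'' i (Suc j) = bits Z X i (Suc j)"
        using B i(1) 6(1) Z by (auto simp: problem_size_def)
      ultimately show ?case
        using 6(1,3,4) speed by (intro runs_RAssign) (auto simp: update_def loadedD)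
    qed (use Z in \<open>auto simp: update_def problem_size_def\<close>)
    then have "runs (For ''j'' (nvar ''n'')
       (RAssign ''start'' (nvar ''i'') (NConst 0) (RAdd (RRead ''start'' (nvar ''i'') (NConst 0))
         (RMul (ROfNat (NRead ''B'' (nvar ''i'') (nvar ''j'')))
           (RDiv (RRead ''w'' (nvar ''j'') (NConst 0)) (RRead ''speed'' (nvar ''j'') (NConst 0))))))) ?s2
       (Z * 3 + 2) (?done (Suc r))"
      by (rule runs_mono) (use 6(4) Z in \<open>auto simp: candidate_sel(3) atLeastAtMostSuc_conv i_def\<close>)
    then show ?case
      using i(2) by (intro runs_RAssign_Seq[where T="Z * 3 + 2"]) simp_all
  qed (use Z in \<open>auto simp: update_def problem_size_def\<close>)
  then show ?thesis by (rule runs_mono) auto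
qed

section \<open>Testing feasibility and computing the energy\<close>

definition conflict :: "problem \<Rightarrow> schedule \<Rightarrow> nat \<Rightarrow> nat \<Rightarrow> bool" where
  "conflict P S i j \<longleftrightarrow> deadline P < completion P S i \<or>
     i \<noteq> j \<and> task_core S i = task_core S j \<and> task_start S j < completion P S i \<and>
       task_start S i < completion P S j \<or>
     (i, j) \<in> arcs P \<and> task_start S j < completion P S i"

text \<open>Decoding always yields legal speeds, legal cores and nonnegative starts, so only
  deadline, overlap and precedence remain. The deadline concerns one task, but including it in a
  relation on pairs lets one double loop test everything.\<close>

lemma feasible_candidate_iff:
  assumes wf: "well_formed P"
  shows "feasible_schedule P (candidate P X) \<longleftrightarrow>
    (\<forall>i\<in>tasks P. \<forall>j\<in>tasks P. \<not> conflict P (candidate P X) i j)"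
proof -
  let ?C = "candidate P X"
  have speed: "task_speed ?C i \<in> speed P ` {1..nspeeds P}" for i
    using wf unfolding candidate_sel well_formed_def by (intro imageI sum_bits_less) simp
  have core: "task_core ?C i \<in> {1..ncores P}" for i
    using wf unfolding candidate_sel well_formed_def by (intro sum_bits_less) simp
  have "0 \<le> task_start ?C i" for i
    unfolding candidate_sel(3)
  proof (rule sum_nonneg)
    fix j assume "j \<in> tasks P"
    then have "0 \<le> weight P j" using wf unfolding well_formed_def by blast
    moreover obtain l where "l \<in> {1..nspeeds P}" "task_speed ?C j = speed P l"
      using speed[of j] by blast
    with speed_pos[OF wf] have "0 < task_speed ?C j" by simp
    ultimately show "0 \<le> real (bits (problem_size P) X i j) * (weight P j / task_speed ?C j)"
      by simp
  qed
  moreover have "arcs P \<subseteq> tasks P \<times> tasks P"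
    using wf by (simp add: well_formed_def)
  then have "(\<forall>(i, j)\<in>arcs P. completion P ?C i \<le> task_start ?C j) \<longleftrightarrow>
    (\<forall>i\<in>tasks P. \<forall>j\<in>tasks P. (i, j) \<in> arcs P \<longrightarrow> completion P ?C i \<le> task_start ?C j)"
    by blast
  ultimately show ?thesis
    using speed core unfolding feasible_schedule_def conflict_def by (simp only:) (meson not_le)
qed

abbreviation BOr :: "bexp \<Rightarrow> bexp \<Rightarrow> bexp" where
  "BOr b c \<equiv> BNot (BAnd (BNot b) (BNot c))"

abbreviation NEq :: "nexp \<Rightarrow> nexp \<Rightarrow> bexp" where
  "NEq p q \<equiv> BAnd (BNot (NLess p q)) (BNot (NLess q p))"

definition completion_exp :: "string \<Rightarrow> rexp" where
  "completion_exp i = RAdd (RRead ''start'' (nvar i) (NConst 0))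
     (RDiv (RRead ''w'' (nvar i) (NConst 0)) (RRead ''speed'' (nvar i) (NConst 0)))"

definition conflict_exp :: bexp where
  "conflict_exp =
     BOr (RLess (rvar ''D'') (completion_exp ''i''))
     (BOr (BAnd (BNot (NEq (nvar ''i'') (nvar ''j'')))
        (BAnd (NEq (NRead ''core'' (nvar ''i'') (NConst 0)) (NRead ''core'' (nvar ''j'') (NConst 0)))
        (BAnd (RLess (RRead ''start'' (nvar ''j'') (NConst 0)) (completion_exp ''i''))
          (RLess (RRead ''start'' (nvar ''i'') (NConst 0)) (completion_exp ''j'')))))
      (BAnd (NLess (NConst 0) (NRead ''E'' (nvar ''i'') (nvar ''j'')))
        (RLess (RRead ''start'' (nvar ''j'') (NConst 0)) (completion_exp ''i''))))"

text \<open>Outside the tasks the memory may differ from the schedule;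
  \<open>feasible_schedule_cong\<close> and \<open>energy_cong\<close> absorb this.\<close>

definition holds :: "problem \<Rightarrow> schedule \<Rightarrow> memory \<Rightarrow> bool" where
  "holds P S s \<longleftrightarrow> (\<forall>i\<in>tasks P. reals s ''speed'' i 0 = task_speed S i \<and>
     nats s ''core'' i 0 = task_core S i \<and> reals s ''start'' i 0 = task_start S i)"

lemma holds_agree:
  "holds P S s \<Longrightarrow> agree W s s' \<Longrightarrow> W \<inter> {''speed'', ''core'', ''start''} = {} \<Longrightarrow> holds P S s'"
  by (auto simp: holds_def agree_def)

lemma bval_conflict_exp:
  assumes "loaded P s" "holds P S s" "nats s ''i'' 0 0 = i" "nats s ''j'' 0 0 = j"
    "i \<in> tasks P" "j \<in> tasks P"
  shows "bval conflict_exp s \<longleftrightarrow> conflict P S i j"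
  using assms
  by (auto simp: conflict_exp_def completion_exp_def conflict_def completion_def loadedD holds_def)

definition check :: com where
  "check = Seq (nset ''bad'' (NConst 0))
     (For ''i'' (nvar ''n'') (For ''j'' (nvar ''n'') (If conflict_exp (nset ''bad'' (NConst 1)) Skip)))"

lemma writes_check: "writes check = {''bad'', ''i'', ''j''}"
  by (auto simp: check_def)

lemma runs_check:
  assumes ld: "loaded P s" and holds: "holds P S s" and Z: "problem_size P = Z"
  shows "runs check s (Z * (Z * 4 + 4) + 3)
    (\<lambda>s'. nats s' ''bad'' 0 0 = 0 \<longleftrightarrow> (\<forall>i\<in>tasks P. \<forall>j\<in>tasks P. \<not> conflict P S i j))"
proof -
  \<comment> \<open>Rows up to \<open>r\<close> and the first \<open>j\<close> entries of the next
    row have been tested, so \<open>?I r (ntasks P)\<close> amounts to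
    \<open>?I (Suc r) 0\<close>.\<close>
  let ?I = "\<lambda>r j (s :: memory). nats s ''bad'' 0 0 = 0 \<longleftrightarrow>
    (\<forall>i\<in>{1..r}. \<forall>j\<in>tasks P. \<not> conflict P S i j) \<and> (\<forall>j\<in>{1..j}. \<not> conflict P S (Suc r) j)"
  let ?s = "s\<lparr>nats := update (nats s) ''bad'' 0 0 0\<rparr>"
  have fr: "agree {''bad''} s ?s" by (simp add: agree_def update_def)
  have "runs (For ''i'' (nvar ''n'') (For ''j'' (nvar ''n'') (If conflict_exp (nset ''bad'' (NConst 1)) Skip)))
      ?s (Z * (Z * (2 + 2) + 2 + 2) + 2) (?I (ntasks P) 0)"
  proof (rule runs_For[where I="\<lambda>r. ?I r 0"], goal_cases)
    case (3 s')
    then have "loaded P s'" using ld agree_trans[OF fr] by (elim loaded_agree) (auto simp: inputs_def)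
    then show ?case by (simp add: loadedD)
  next
    case (6 r s1)
    from agree_trans[OF fr 6(2)] have fr1: "agree {''bad'', ''i'', ''j''} s s1"
      by (simp add: agree_def)
    have "runs (For ''j'' (nvar ''n'') (If conflict_exp (nset ''bad'' (NConst 1)) Skip)) s1
      (Z * (2 + 2) + 2) (?I r (ntasks P))"
    proof (rule runs_For[where I="?I r"], goal_cases)
      case (3 s')
      then have "loaded P s'" using ld agree_trans[OF fr1] by (elim loaded_agree) (auto simp: inputs_def)
      then show ?case by (simp add: loadedD)
    next
      case (6 j s2)
      have fr2: "agree {''bad'', ''i'', ''j''} s s2"
        using fr1 6(2) by (simp add: agree_def)
      have "nats s2 ''i'' 0 0 = Suc r"
        using 6(2) \<open>nats s1 ''i'' 0 0 = Suc r\<close> by (simp add: agree_def)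
      moreover have "loaded P s2" using ld fr2 by (elim loaded_agree) (auto simp: inputs_def)
      moreover have "holds P S s2" using holds fr2 by (rule holds_agree) simp
      ultimately have "bval conflict_exp s2 \<longleftrightarrow> conflict P S (Suc r) (Suc j)"
        using 6(1,3) \<open>r < ntasks P\<close> by (intro bval_conflict_exp) simp_all
      with 6(4) have "runs (If conflict_exp (nset ''bad'' (NConst 1)) Skip) s2 2 (?I r (Suc j))"
        by (intro runs_If[where T=1] runs_NAssign runs_Skip) (auto simp: update_def atLeastAtMostSuc_conv)
      then show ?case .
    qed (use Z 6(4) in \<open>auto simp: update_def problem_size_def\<close>)
    then show ?case
      by (rule runs_mono) (auto simp: atLeastAtMostSuc_conv)
  qed (use Z in \<open>auto simp: update_def problem_size_def\<close>)
  then have "runs (For ''i'' (nvar ''n'') (For ''j'' (nvar ''n'') (If conflict_exp (nset ''bad'' (NConst 1)) Skip)))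
      ?s (Z * (Z * 4 + 4) + 2)
      (\<lambda>s'. nats s' ''bad'' 0 0 = 0 \<longleftrightarrow> (\<forall>i\<in>tasks P. \<forall>j\<in>tasks P. \<not> conflict P S i j))"
    by (rule runs_mono) (simp_all add: algebra_simps)
  then show ?thesis
    unfolding check_def by (intro runs_NAssign_Seq[where T="Z * (Z * 4 + 4) + 2"]) simp_all
qed

definition set_energy :: com where
  "set_energy = Seq (rset ''en'' (ROfNat (NConst 0)))
     (For ''i'' (nvar ''n'') (rset ''en'' (RAdd (rvar ''en'')
       (RMul (RRead ''w'' (nvar ''i'') (NConst 0))
         (RPowr (RRead ''speed'' (nvar ''i'') (NConst 0)) (RSub (rvar ''alpha'') (ROfNat (NConst 1))))))))"

lemma writes_set_energy: "writes set_energy = {''en'', ''i''}"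
  by (auto simp: set_energy_def)

lemma runs_set_energy:
  assumes ld: "loaded P s" and holds: "holds P S s" and Z: "problem_size P = Z"
  shows "runs set_energy s (Z * 3 + 3) (\<lambda>s'. reals s' ''en'' 0 0 = energy P S)"
proof -
  let ?s = "s\<lparr>reals := update (reals s) ''en'' 0 0 0\<rparr>"
  have fr: "agree {''en''} s ?s" by (simp add: agree_def update_def)
  have "runs (For ''i'' (nvar ''n'') (rset ''en'' (RAdd (rvar ''en'')
       (RMul (RRead ''w'' (nvar ''i'') (NConst 0))
         (RPowr (RRead ''speed'' (nvar ''i'') (NConst 0)) (RSub (rvar ''alpha'') (ROfNat (NConst 1))))))))
      ?s (Z * (1 + 2) + 2) (\<lambda>s'. reals s' ''en'' 0 0 = energy P S)"
    unfolding energy_def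
  proof (rule runs_For[where I="\<lambda>r (s :: memory). reals s ''en'' 0 0 =
      (\<Sum>i=1..r. weight P i * task_speed S i powr (alpha P - 1))"], goal_cases)
    case (3 s')
    then have "loaded P s'" using ld agree_trans[OF fr] by (elim loaded_agree) (auto simp: inputs_def)
    then show ?case by (simp add: loadedD)
  next
    case (6 r s1)
    from agree_trans[OF fr 6(2)] have fr1: "agree {''en'', ''i''} s s1"
      by (simp add: agree_def)
    then have "loaded P s1" using ld by (elim loaded_agree) (auto simp: inputs_def)
    moreover have "holds P S s1" using holds fr1 by (rule holds_agree) simp
    ultimately show ?case
      using 6(1,3,4) by (intro runs_RAssign) (auto simp: update_def loadedD holds_def)
  qed (use Z in \<open>auto simp: update_def problem_size_def\<close>)
  then show ?thesis
    unfolding set_energy_def by (intro runs_RAssign_Seq[where T="Z * (1 + 2) + 2"]) simp_all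
qed

definition evaluate :: com where
  "evaluate = Seq read_bits (Seq read_machines (Seq set_starts (Seq check set_energy)))"

lemma writes_evaluate:
  "writes evaluate = {''q'', ''t'', ''B'', ''y'', ''i'', ''j'', ''core'', ''l'', ''speed'', ''start'', ''bad'', ''en''}"
  by (auto simp: evaluate_def writes_read_bits writes_read_machines writes_set_starts writes_check
      writes_set_energy)

definition evaluate_time :: "nat \<Rightarrow> nat \<Rightarrow> nat" where
  "evaluate_time Z M = Z * (Z * (M * 3 + 7) + 4) + 3 + (Z * (Z * 6 + 9) + 2 +
     (Z * (Z * 3 + 5) + 2 + (Z * (Z * 4 + 4) + 3 + (Z * 3 + 3))))"

lemma runs_evaluate:
  assumes wf: "well_formed P" and ld: "loaded P s" and Z: "problem_size P = Z"
    and X: "nats s ''x'' 0 0 - 1 = X" "X \<le> M"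
  shows "runs evaluate s (evaluate_time Z M) (\<lambda>s'. holds P (candidate P X) s' \<and>
    (nats s' ''bad'' 0 0 = 0 \<longleftrightarrow> feasible_schedule P (candidate P X)) \<and>
    reals s' ''en'' 0 0 = energy P (candidate P X))"
  unfolding evaluate_def evaluate_time_def
proof (rule runs_Seq[where V="Z * (Z * 6 + 9) + 2 + (Z * (Z * 3 + 5) + 2 + (Z * (Z * 4 + 4) + 3 + (Z * 3 + 3)))", OF runs_read_bits[OF ld Z X]], goal_cases)
  case (1 s1)
  have ld1: "loaded P s1"
    using ld 1(2) by (elim loaded_agree) (auto simp: writes_read_bits inputs_def)
  show ?case
  proof (rule runs_Seq[where V="Z * (Z * 3 + 5) + 2 + (Z * (Z * 4 + 4) + 3 + (Z * 3 + 3))", OF runs_read_machines[OF wf ld1 Z 1(1)]], goal_cases)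
    case (1 s2)
    have ld2: "loaded P s2"
      using ld1 1(2) by (elim loaded_agree) (auto simp: writes_read_machines inputs_def)
    have B2: "\<forall>i\<in>tasks P. \<forall>j\<in>{1..Z}. nats s2 ''B'' i j = bits Z X i j"
      using \<open>\<forall>i\<in>tasks P. \<forall>j\<in>{1..Z}. nats s1 ''B'' i j = bits Z X i j\<close> 1(2)
      by (simp add: agree_def writes_read_machines)
    have speed2: "\<forall>i\<in>tasks P. reals s2 ''speed'' i 0 = task_speed (candidate P X) i"
      using 1(1) by blast
    note machines = 1(1)
    show ?case
    proof (rule runs_Seq[where V="Z * (Z * 4 + 4) + 3 + (Z * 3 + 3)", OF runs_set_starts[OF ld2 Z B2 speed2]], goal_cases)
      case (1 s3)
      have ld3: "loaded P s3"
        using ld2 1(2) by (elim loaded_agree) (auto simp: writes_set_starts inputs_def)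
      have holds3: "holds P (candidate P X) s3"
        using machines 1 by (auto simp: holds_def agree_def writes_set_starts)
      show ?case
      proof (rule runs_Seq[where V="Z * 3 + 3", OF runs_check[OF ld3 holds3 Z]], goal_cases)
        case (1 s4)
        have ld4: "loaded P s4"
          using ld3 1(2) by (elim loaded_agree) (auto simp: writes_check inputs_def)
        have holds4: "holds P (candidate P X) s4"
          using holds3 1(2) by (rule holds_agree) (simp add: writes_check)
        show ?case
        proof (rule runs_mono[OF runs_set_energy[OF ld4 holds4 Z] order_refl])
          fix s5 assume en: "reals s5 ''en'' 0 0 = energy P (candidate P X)"
            and fr: "agree (writes set_energy) s4 s5"
          have "holds P (candidate P X) s5"
            using holds4 fr by (rule holds_agree) (simp add: writes_set_energy)
          moreover have "nats s5 ''bad'' = nats s4 ''bad''"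
            using fr by (simp add: agree_def writes_set_energy)
          ultimately show "holds P (candidate P X) s5 \<and>
            (nats s5 ''bad'' 0 0 = 0 \<longleftrightarrow> feasible_schedule P (candidate P X)) \<and>
            reals s5 ''en'' 0 0 = energy P (candidate P X)"
            using 1(1) en feasible_candidate_iff[OF wf] by simp
        qed
      qed simp
    qed simp
  qed simp
qed simp

section \<open>The search for the cheapest candidate\<close>

definition search :: com where
  "search = For ''x'' (nvar ''L'') (Seq evaluate
     (If (BAnd (NEq (nvar ''bad'') (NConst 0))
         (BOr (NEq (nvar ''found'') (NConst 0)) (RLess (rvar ''en'') (rvar ''best''))))
       (Seq (nset ''found'' (NConst 1)) (Seq (nset ''bestx'' (nvar ''x'')) (rset ''best'' (rvar ''en''))))
       Skip))"

lemma writes_search: "writes search = {''x'', ''found'', ''bestx'', ''best''} \<union> writes evaluate"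
  by (auto simp: search_def)

definition best_among :: "problem \<Rightarrow> nat \<Rightarrow> nat \<Rightarrow> bool" where
  "best_among P r X \<longleftrightarrow> X < r \<and> feasible_schedule P (candidate P X) \<and>
     (\<forall>Y<r. feasible_schedule P (candidate P Y) \<longrightarrow> energy P (candidate P X) \<le> energy P (candidate P Y))"

text \<open>The counter \<open>x\<close> is one larger than the number of the candidate, hence the successor.\<close>

definition search_inv :: "problem \<Rightarrow> nat \<Rightarrow> memory \<Rightarrow> bool" where
  "search_inv P r s \<longleftrightarrow>
     nats s ''found'' 0 0 = 0 \<and> nats s ''bestx'' 0 0 = 0 \<and> (\<forall>X<r. \<not> feasible_schedule P (candidate P X)) \<or>
     nats s ''found'' 0 0 = 1 \<and> (\<exists>X. nats s ''bestx'' 0 0 = Suc X \<and>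
       reals s ''best'' 0 0 = energy P (candidate P X) \<and> best_among P r X)"

lemma search_inv_infeasible:
  assumes "search_inv P r s" "\<not> feasible_schedule P (candidate P r)"
  shows "search_inv P (Suc r) s"
  using assms by (auto simp: search_inv_def best_among_def less_Suc_eq)

lemma search_inv_worse:
  assumes "search_inv P r s" "nats s ''found'' 0 0 \<noteq> 0" "reals s ''best'' 0 0 \<le> energy P (candidate P r)"
  shows "search_inv P (Suc r) s"
  using assms by (auto simp: search_inv_def best_among_def less_Suc_eq)

text \<open>Before anything is found, all earlier candidates are infeasible; afterwards, being
  cheaper than the stored best means being cheaper than every earlier feasible candidate.\<close>

lemma best_among_better:
  assumes "search_inv P r s" "feasible_schedule P (candidate P r)"
    "nats s ''found'' 0 0 = 0 \<or> energy P (candidate P r) < reals s ''best'' 0 0"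
  shows "best_among P (Suc r) r"
  using assms unfolding search_inv_def best_among_def
  by (auto simp: less_Suc_eq)

lemma runs_search:
  assumes wf: "well_formed P" and ld: "loaded P s" and Z: "problem_size P = Z"
    and L: "nats s ''L'' 0 0 = L" "L \<le> M"
    and init: "nats s ''found'' 0 0 = 0" "nats s ''bestx'' 0 0 = 0"
  shows "runs search s (M * (evaluate_time Z M + 6) + 2) (search_inv P L)"
proof -
  have "runs search s (M * (evaluate_time Z M + 4 + 2) + 2) (search_inv P L)"
    unfolding search_def
  proof (rule runs_For[where I="search_inv P"], goal_cases)
    case 1
    show ?case by (simp add: writes_evaluate)
  next
    case 2
    show ?case by (fact L(2))
  next
    case (3 s')
    then show ?case using L(1) by (simp add: agree_def writes_evaluate)
  next
    case 4
    show ?case using init by (simp add: search_inv_def)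
  next
    case (5 j s' v)
    then show ?case by (simp add: search_inv_def update_def)
  next
    case (6 X s1)
    have ld1: "loaded P s1"
      using ld 6(2) by (elim loaded_agree) (auto simp: writes_evaluate inputs_def)
    have X: "nats s1 ''x'' 0 0 - 1 = X" "X \<le> M" using 6(1,3) L(2) by simp_all
    show ?case
    proof (rule runs_Seq[where V=4, OF runs_evaluate[OF wf ld1 Z X]], goal_cases)
      case (1 s2)
      have x: "nats s2 ''x'' 0 0 = Suc X"
        using 6(3) 1(2) by (simp add: agree_def writes_evaluate)
      have inv: "search_inv P X s2"
        using 6(4) 1(2) by (simp add: search_inv_def agree_def writes_evaluate)
      show ?case
      proof (rule runs_If[where T=3])
        assume b: "bval (BAnd (NEq (nvar ''bad'') (NConst 0))
          (BOr (NEq (nvar ''found'') (NConst 0)) (RLess (rvar ''en'') (rvar ''best'')))) s2"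
        then have "best_among P (Suc X) X"
          using 1(1) inv by (intro best_among_better[of P X s2]) auto
        with x 1(1) show "runs (Seq (nset ''found'' (NConst 1))
            (Seq (nset ''bestx'' (nvar ''x'')) (rset ''best'' (rvar ''en'')))) s2 3 (search_inv P (Suc X))"
          by (intro runs_NAssign_Seq[where T=2] runs_NAssign_Seq[where T=1] runs_RAssign)
            (simp_all add: update_def search_inv_def)
      next
        assume b: "\<not> bval (BAnd (NEq (nvar ''bad'') (NConst 0))
          (BOr (NEq (nvar ''found'') (NConst 0)) (RLess (rvar ''en'') (rvar ''best'')))) s2"
        then have "search_inv P (Suc X) s2"
          using search_inv_infeasible[OF inv] search_inv_worse[OF inv] 1(1) by auto
        then show "runs Skip s2 3 (search_inv P (Suc X))"
          by (rule runs_Skip)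
      qed simp
    qed simp
  qed
  then show ?thesis by (simp add: add.commute)
qed

text \<open>The schedule arrays are overwritten by each evaluation and end up with the last
  candidate. A final evaluation of the remembered number restores the best one.\<close>

definition ilp_program :: com where
  "ilp_program = Seq set_limit (Seq search (Seq (nset ''x'' (nvar ''bestx'')) evaluate))"

text \<open>The exponent is \<open>Z * Z\<close> because the bound may depend on the problem size
  only. The same \<open>M\<close> bounds the number of rounds and the numbers that are
  decoded.\<close>

definition program_time :: "nat \<Rightarrow> nat" where
  "program_time Z = (let M = 2 ^ (Z * Z) in
     (Z * (Z * 3 + 4) + 3) + (M * (evaluate_time Z M + 6) + 2 + (evaluate_time Z M + 1)))"

lemma runs_ilp_program:
  assumes wf: "well_formed P" and Z: "problem_size P = Z"
  shows "runs ilp_program (input_memory P) (program_time Z) (\<lambda>s.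
    if \<exists>S. feasible_schedule P S
    then output_found s \<and> optimal_schedule P (output_schedule s)
    else \<not> output_found s)"
proof -
  let ?L = "2 ^ (ntasks P * Z) :: nat" and ?M = "2 ^ (Z * Z) :: nat"
  have L: "?L \<le> ?M"
    using Z by (intro power_increasing mult_le_mono1) (simp_all add: problem_size_def)
  have ld: "loaded P (input_memory P)"
    by (simp add: loaded_def agree_refl)
  show ?thesis
    unfolding ilp_program_def program_time_def Let_def
  proof (rule runs_Seq[where V="?M * (evaluate_time Z ?M + 6) + 2 + (evaluate_time Z ?M + 1)", OF runs_set_limit[OF ld Z]], goal_cases)
    case (1 s1)
    have ld1: "loaded P s1"
      using ld 1(2) by (elim loaded_agree) (auto simp: writes_set_limit inputs_def)
    have "nats s1 ''found'' 0 0 = 0" "nats s1 ''bestx'' 0 0 = 0"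
      using 1(2) by (simp_all add: agree_def writes_set_limit input_memory_def)
    note search = runs_search[OF wf ld1 Z 1(1) L this]
    show ?case
    proof (rule runs_Seq[where V="evaluate_time Z ?M + 1", OF search], goal_cases)
      case (1 s2)
      let ?s3 = "s2\<lparr>nats := update (nats s2) ''x'' 0 0 (nats s2 ''bestx'' 0 0)\<rparr>"
      have "agree (insert ''x'' (writes search)) s1 ?s3"
        using 1(2) by (simp add: agree_def update_def)
      with ld1 have ld3: "loaded P ?s3"
        by (elim loaded_agree) (auto simp: writes_search writes_evaluate inputs_def)
      \<comment> \<open>If nothing was found, \<open>bestx\<close> is 0 and truncated subtraction
        gives \<open>X = 0\<close>. The final evaluation is then harmless: it stays within its
        budget and does not touch \<open>found\<close>.\<close>
      define X where "X = nats ?s3 ''x'' 0 0 - 1"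
      have "X \<le> ?L"
        using 1(1) by (auto simp: X_def update_def search_inv_def best_among_def)
      then have "X \<le> ?M" using L by (rule order_trans)
      note eval = runs_evaluate[OF wf ld3 Z X_def[symmetric] this]
      have "runs evaluate ?s3 (evaluate_time Z ?M) (\<lambda>s. if \<exists>S. feasible_schedule P S
          then output_found s \<and> optimal_schedule P (output_schedule s) else \<not> output_found s)"
      proof (rule runs_mono[OF eval order_refl], elim conjE)
        fix s assume holds: "holds P (candidate P X) s" and fr: "agree (writes evaluate) ?s3 s"
        have found: "nats s ''found'' 0 0 = nats s2 ''found'' 0 0"
          using fr by (simp add: agree_def writes_evaluate update_def)
        show "if \<exists>S. feasible_schedule P S
          then output_found s \<and> optimal_schedule P (output_schedule s) else \<not> output_found s"
        proof (cases "\<exists>S. feasible_schedule P S")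
          case True
          then obtain Y where "Y < ?L" "feasible_schedule P (candidate P Y)"
            using candidates_cover[OF wf] Z by blast
          with 1(1) have "nats s2 ''found'' 0 0 = 1" and best: "best_among P ?L X"
            by (auto simp: search_inv_def X_def update_def)
          moreover have opt: "optimal_schedule P (candidate P X)"
            using best Z by (intro optimal_candidateI[OF wf]) (simp_all add: best_among_def)
          have "feasible_schedule P (output_schedule s) \<longleftrightarrow> feasible_schedule P (candidate P X)"
            using wf holds
            by (intro feasible_schedule_cong) (simp_all add: well_formed_def holds_def output_schedule_def)
          moreover have "energy P (output_schedule s) = energy P (candidate P X)"
            using holds by (intro energy_cong) (simp add: holds_def output_schedule_def)
          ultimately show ?thesis
            using True opt found by (simp add: output_found_def optimal_schedule_def)
        next
          case False
          with 1(1) have "nats s2 ''found'' 0 0 = 0"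
            by (auto simp: search_inv_def best_among_def)
          with False found show ?thesis by (simp add: output_found_def)
        qed
      qed
      then show ?case
        by (intro runs_NAssign_Seq[where T="evaluate_time Z ?M"]) simp_all
    qed simp
  qed simp
qed

section \<open>Exponential time bounds\<close>

definition exp_bounded :: "(nat \<Rightarrow> nat) \<Rightarrow> bool" where
  "exp_bounded f \<longleftrightarrow> (\<exists>p :: nat poly. \<forall>z. f z \<le> 2 ^ poly p z)"

lemma exp_bounded_const: "exp_bounded (\<lambda>_. c)"
  unfolding exp_bounded_def by (rule exI[of _ "[:c:]"]) (simp add: less_imp_le)

lemma exp_bounded_id: "exp_bounded (\<lambda>z. z)"
  unfolding exp_bounded_def by (rule exI[of _ "[:0, 1:]"]) (simp add: less_imp_le)

lemma exp_bounded_power_square: "exp_bounded (\<lambda>z. 2 ^ (z * z))"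
  unfolding exp_bounded_def by (rule exI[of _ "[:0, 0, 1:]"]) simp

lemma exp_bounded_mult:
  assumes "exp_bounded f" "exp_bounded g"
  shows "exp_bounded (\<lambda>z. f z * g z)"
proof -
  from assms obtain p q :: "nat poly" where "\<And>z. f z \<le> 2 ^ poly p z" "\<And>z. g z \<le> 2 ^ poly q z"
    unfolding exp_bounded_def by blast
  then show ?thesis
    unfolding exp_bounded_def by (intro exI[of _ "p + q"]) (simp add: power_add mult_le_mono)
qed

lemma exp_bounded_add:
  assumes "exp_bounded f" "exp_bounded g"
  shows "exp_bounded (\<lambda>z. f z + g z)"
proof -
  from assms obtain p q :: "nat poly" where pq: "\<And>z. f z \<le> 2 ^ poly p z" "\<And>z. g z \<le> 2 ^ poly q z"
    unfolding exp_bounded_def by blast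
  \<comment> \<open>Each of the two powers is at least 1 and hence at most their product; the extra
    1 in the exponent doubles the product.\<close>
  have "f z + g z \<le> 2 ^ poly (p + q + 1) z" for z
  proof -
    have "(2 :: nat) ^ poly p z \<le> 2 ^ poly p z * 2 ^ poly q z"
      "(2 :: nat) ^ poly q z \<le> 2 ^ poly p z * 2 ^ poly q z"
      by simp_all
    with add_mono[OF pq[of z]] show ?thesis
      by (simp only: poly_add poly_1 power_add power_one_right)
  qed
  then show ?thesis unfolding exp_bounded_def by blast
qed

text \<open>The expression is built from constants, \<open>z\<close> and \<open>2 ^ (z * z)\<close>
  by sums and products, under which the class is closed, so its exact shape does not matter.\<close>

lemma exp_bounded_program_time: "exp_bounded program_time"
proof -
  have "exp_bounded (\<lambda>z. program_time z)"
    unfolding program_time_def evaluate_time_def Let_def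
    by (intro exp_bounded_add exp_bounded_mult exp_bounded_power_square exp_bounded_id exp_bounded_const)
  then show ?thesis .
qed

theorem theorem6:
  shows "(\<forall>P. well_formed P \<longrightarrow>
            (\<forall>S. ILP_D_sched P S \<longrightarrow> optimal_schedule P S) \<and>
            ((\<exists>S. feasible_schedule P S) \<longrightarrow> (\<exists>S. ILP_D_sched P S))) \<and>
         (\<exists>(prog :: com) (p :: nat poly). \<forall>P. well_formed P \<longrightarrow>
            (\<exists>t s. exec prog (input_memory P) t s \<and>
                   t \<le> 2 ^ poly p (problem_size P) \<and>
                   (if \<exists>S. feasible_schedule P S
                    then output_found s \<and> ILP_D_sched P (output_schedule s)
                    else \<not> output_found s)))"
proof
  show "\<forall>P. well_formed P \<longrightarrow> (\<forall>S. ILP_D_sched P S \<longrightarrow> optimal_schedule P S) \<and>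
      ((\<exists>S. feasible_schedule P S) \<longrightarrow> (\<exists>S. ILP_D_sched P S))"
    \<comment> \<open>Existence of an output amounts to existence of an optimal schedule, and the
      finite set of candidates provides one.\<close>
    using ILP_D_sched_iff_optimal ex_optimal_schedule by blast
  obtain p :: "nat poly" where p: "\<And>z. program_time z \<le> 2 ^ poly p z"
    using exp_bounded_program_time unfolding exp_bounded_def by blast
  have "\<exists>t s. exec ilp_program (input_memory P) t s \<and> t \<le> 2 ^ poly p (problem_size P) \<and>
      (if \<exists>S. feasible_schedule P S then output_found s \<and> ILP_D_sched P (output_schedule s)
       else \<not> output_found s)" if wf: "well_formed P" for P
    using runs_ilp_program[OF wf refl] p[of "problem_size P"]
    unfolding ILP_D_sched_iff_optimal[OF wf] runs_def by (meson order_trans)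
  then show "\<exists>(prog :: com) (p :: nat poly). \<forall>P. well_formed P \<longrightarrow>
      (\<exists>t s. exec prog (input_memory P) t s \<and> t \<le> 2 ^ poly p (problem_size P) \<and>
        (if \<exists>S. feasible_schedule P S then output_found s \<and> ILP_D_sched P (output_schedule s)
         else \<not> output_found s))"
    by blast
qed

end
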